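(* Let $D$, $H$, $(e_k)$, $(\lambda_k)$, $\Psi$, $N_0$ be as described in the context (in particular the three assumptions on $(\lambda_k)$ and $\Psi$ listed there hold), and let $\nu\in\mathcal M$ with constant $\lambda_\nu\in(0,\infty)$. Let $(N_2,D(N_2))$ be the closure of $(N_0,C_b^2(H))$ on $L^2(H,\nu)$ and let $P_t:=e^{tN_2}$, $t\ge0$, be the $C_0$-semigroup on $L^2(H,\nu)$ generated by $N_2$. Then: (i) For $f\in D(N_2)$, $v(t,\cdot):=P_tf$, $t>0$, solves $\frac{dv}{dt}=N_2v$, $v(0,\cdot)=f$, in $L^2(H,\nu)$. (ii) $(P_t)_{t\ge0}$ is Markovian, i.e. $P_t1=1$ and $P_tf\ge0$ for all nonnegative $f\in L^2(H,\nu)$ and all $t\ge0$. (iii) For every nonnegative $f\in L^2(H,\nu)$ and every $t>0$, $$\int_HP_tf\,d\nu\le e^{\lambda_\nu t}\int_Hf\,d\nu.$$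
   Context: Let $D\subset\mathbb R^d$ be a bounded open set and $H:=H^{-1}(D)$ the dual of the Sobolev space $H_0^1(D)$ (via $H_0^1(D)\subset L^2(D)\subset H^{-1}(D)$), with inner product $\langle\cdot,\cdot\rangle_H$ and norm $|x|_H^2=\int_D((-\Delta)^{-1}x)(\xi)\,x(\xi)\,d\xi$, where $\Delta$ is the Dirichlet Laplacian. Let $\{e_k:k\in\mathbb N\}$ be the orthonormal eigenbasis of $\Delta$ in $H$. Assumptions. (1) $C$ is a bounded trace class operator on $H$ with $Ce_k=\lambda_ke_k$, $\lambda_k\in[0,\infty)$, for all $k\in\mathbb N$. (2) With $\alpha_k:=\sup_{\xi\in D}|e_k(\xi)|^2$ one has $\sum_{k=1}^\infty\alpha_k\lambda_k<\infty$. (3) $\Psi\in C^1(\mathbb R)$ and there are $r\in(1,\infty)$ and $\kappa_0,\kappa_1,C_1>0$ such that $\kappa_0|s|^{r-1}\le\Psi'(s)\le\kappa_1|s|^{r-1}+C_1$ for all $s\in\mathbb R$. $C_b^2(H)$ is the space of bounded twice continuously Fréchet differentiable functions $\varphi:H\to\mathbb R$ with bounded first and second derivatives. Put $H_\Psi:=\{x\in L^2(D):\Psi(x)\in H_0^1(D)\}$. For $\varphi\in C_b^2(H)$ and $x\in H_\Psi$ define $$N_0\varphi(x)=\frac12\sum_{k=1}^\infty\lambda_kD^2\varphi(x)(e_k,e_k)+D\varphi(x)(\Delta(\Psi(x))).$$ $\mathcal M$ (the infinitesimally excessive measures) is the set of all probability measures $\nu$ on $H$ such that $\int_H\int_D|\nabla(\Psi(x))(\xi)|^2\,d\xi\,\nu(dx)<\infty$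 (in particular $\nu(H_\Psi)=1$), and for which there is $\lambda_\nu\in(0,\infty)$ with $$\int_HN_0\varphi\,d\nu\le\lambda_\nu\int_H\varphi\,d\nu\quad\text{for all }\varphi\in C_b^2(H)\text{ with }\varphi\ge0\ \nu\text{-a.e.}$$ $N_0$ is regarded as an operator on $L^2(H,\nu)$ whose domain is the set of $\nu$-classes of functions in $C_b^2(H)$ (for $\varphi\in C_b^2(H)$ with $\varphi=0$ $\nu$-a.e. one has $N_0\varphi=0$ $\nu$-a.e.). It is known that $(N_0,C_b^2(H))$ is closable on $L^2(H,\nu)$ and that its closure generates a $C_0$-semigroup on $L^2(H,\nu)$. *)

theory Defs
  imports "HOL-Probability.Probability"
begin

section \<open>Square integrable functions\<close>

text \<open>
  Elements of \<open>L\<^sup>2(M)\<close> are represented by functions; equality in \<open>L\<^sup>2(M)\<close> is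
  equality \<open>M\<close>-almost everywhere.
\<close>

definition Lsq :: "'a measure \<Rightarrow> ('a \<Rightarrow> 'b::euclidean_space) set" where
  "Lsq M = {f \<in> borel_measurable M. integrable M (\<lambda>x. (norm (f x))\<^sup>2)}"

definition Lsq_norm :: "'a measure \<Rightarrow> ('a \<Rightarrow> 'b::euclidean_space) \<Rightarrow> real" where
  "Lsq_norm M f = sqrt (\<integral>x. (norm (f x))\<^sup>2 \<partial>M)"

definition Lsq_tendsto ::
  "'a measure \<Rightarrow> ('i \<Rightarrow> 'a \<Rightarrow> 'b::euclidean_space) \<Rightarrow> ('a \<Rightarrow> 'b) \<Rightarrow> 'i filter \<Rightarrow> bool" where
  "Lsq_tendsto M fs f F \<longleftrightarrow>
     f \<in> Lsq M \<and> (\<forall>\<^sub>F i in F. fs i \<in> Lsq M) \<and>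
     ((\<lambda>i. Lsq_norm M (\<lambda>x. fs i x - f x)) \<longlongrightarrow> 0) F"


section \<open>The Sobolev space \<open>H\<^sub>0\<^sup>1(D)\<close>, its dual, and the Dirichlet Laplacian\<close>

primrec Ck :: "nat \<Rightarrow> ('a::euclidean_space \<Rightarrow> real) \<Rightarrow> bool" where
  "Ck 0 f \<longleftrightarrow> continuous_on UNIV f"
| "Ck (Suc k) f \<longleftrightarrow> f differentiable_on UNIV \<and>
     (\<forall>b\<in>Basis. Ck k (\<lambda>x. frechet_derivative f (at x) b))"

definition test_functions :: "'a::euclidean_space set \<Rightarrow> ('a \<Rightarrow> real) set" where
  "test_functions D = {\<phi>. (\<forall>k. Ck k \<phi>) \<and>
     compact (closure {x. \<phi> x \<noteq> 0}) \<and> closure {x. \<phi> x \<noteq> 0} \<subseteq> D}"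

definition classical_grad :: "('a::euclidean_space \<Rightarrow> real) \<Rightarrow> 'a \<Rightarrow> 'a" where
  "classical_grad \<phi> x = (\<Sum>b\<in>Basis. frechet_derivative \<phi> (at x) b *\<^sub>R b)"

definition is_weak_grad ::
  "'a::euclidean_space set \<Rightarrow> ('a \<Rightarrow> real) \<Rightarrow> ('a \<Rightarrow> 'a) \<Rightarrow> bool" where
  "is_weak_grad D u g \<longleftrightarrow> g \<in> Lsq (lebesgue_on D) \<and>
     (\<forall>\<phi>\<in>test_functions D.
        (\<integral>\<xi>. u \<xi> *\<^sub>R classical_grad \<phi> \<xi> \<partial>lebesgue_on D) =
        - (\<integral>\<xi>. \<phi> \<xi> *\<^sub>R g \<xi> \<partial>lebesgue_on D))"

definition H1 :: "'a::euclidean_space set \<Rightarrow> ('a \<Rightarrow> real) set" where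
  "H1 D = {u \<in> Lsq (lebesgue_on D). \<exists>g. is_weak_grad D u g}"

text \<open>The weak gradient is unique up to null sets.\<close>

definition wgrad :: "'a::euclidean_space set \<Rightarrow> ('a \<Rightarrow> real) \<Rightarrow> 'a \<Rightarrow> 'a" where
  "wgrad D u = (SOME g. is_weak_grad D u g)"

definition H1_norm :: "'a::euclidean_space set \<Rightarrow> ('a \<Rightarrow> real) \<Rightarrow> real" where
  "H1_norm D u = sqrt ((Lsq_norm (lebesgue_on D) u)\<^sup>2 + (Lsq_norm (lebesgue_on D) (wgrad D u))\<^sup>2)"

definition H01 :: "'a::euclidean_space set \<Rightarrow> ('a \<Rightarrow> real) set" where
  "H01 D = {u \<in> H1 D. \<exists>\<phi>. (\<forall>n. \<phi> n \<in> test_functions D) \<and>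
     (\<lambda>n::nat. H1_norm D (\<lambda>\<xi>. \<phi> n \<xi> - u \<xi>)) \<longlonglongrightarrow> 0}"

text \<open>
  The topological dual \<open>H\<^sup>-\<^sup>1(D)\<close> of \<open>H\<^sub>0\<^sup>1(D)\<close>. A functional that is linear and bounded
  for the \<open>H\<^sup>1\<close>-norm does not distinguish functions that agree almost everywhere on \<open>D\<close>.
\<close>

definition Hm1 :: "'a::euclidean_space set \<Rightarrow> (('a \<Rightarrow> real) \<Rightarrow> real) set" where
  "Hm1 D = {l \<in> extensional (H01 D).
     (\<forall>u\<in>H01 D. \<forall>v\<in>H01 D. \<forall>a b. l (\<lambda>\<xi>. a * u \<xi> + b * v \<xi>) = a * l u + b * l v) \<and>
     (\<exists>K. \<forall>u\<in>H01 D. \<bar>l u\<bar> \<le> K * H1_norm D u)}"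

text \<open>The embedding \<open>L\<^sup>2(D) \<subset> H\<^sup>-\<^sup>1(D)\<close>.\<close>

definition L2_functional :: "'a::euclidean_space set \<Rightarrow> ('a \<Rightarrow> real) \<Rightarrow> ('a \<Rightarrow> real) \<Rightarrow> real" where
  "L2_functional D f = (\<lambda>u\<in>H01 D. \<integral>\<xi>. f \<xi> * u \<xi> \<partial>lebesgue_on D)"

text \<open>The Dirichlet Laplacian \<open>\<Delta>: H\<^sub>0\<^sup>1(D) \<rightarrow> H\<^sup>-\<^sup>1(D)\<close> and a representative of \<open>(-\<Delta>)\<^sup>-\<^sup>1 l\<close>.\<close>

definition laplace_functional ::
  "'a::euclidean_space set \<Rightarrow> ('a \<Rightarrow> real) \<Rightarrow> ('a \<Rightarrow> real) \<Rightarrow> real" where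
  "laplace_functional D u = (\<lambda>v\<in>H01 D. - (\<integral>\<xi>. wgrad D u \<xi> \<bullet> wgrad D v \<xi> \<partial>lebesgue_on D))"

definition inv_neg_laplace ::
  "'a::euclidean_space set \<Rightarrow> (('a \<Rightarrow> real) \<Rightarrow> real) \<Rightarrow> 'a \<Rightarrow> real" where
  "inv_neg_laplace D l = (SOME u. u \<in> H01 D \<and> (\<forall>v\<in>H01 D. - laplace_functional D u v = l v))"


section \<open>The Hilbert space \<open>H\<close>\<close>

text \<open>
  The set \<open>Hm1 D\<close> depends on \<open>D\<close>, so it is not a type. To have the library's Hilbert space
  structure, Borel sets and Frechet derivatives on \<open>H\<close>, we work on a type \<open>'h\<close> that is
  identified with \<open>Hm1 D\<close> by a linear bijection \<open>J\<close>, under which the inner product of \<open>'h\<close>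
  is \<open>\<langle>x, y\<rangle> = x((-\<Delta>)\<^sup>-\<^sup>1 y)\<close>, the duality pairing extending the integral of
  \<open>((-\<Delta>)\<^sup>-\<^sup>1 y) x\<close> over \<open>D\<close>.
\<close>

definition is_Hm1 ::
  "'a::euclidean_space set \<Rightarrow> ('h::{real_inner,complete_space} \<Rightarrow> ('a \<Rightarrow> real) \<Rightarrow> real) \<Rightarrow> bool" where
  "is_Hm1 D J \<longleftrightarrow>
     bij_betw J UNIV (Hm1 D) \<and>
     (\<forall>x y a b. \<forall>u\<in>H01 D. J (a *\<^sub>R x + b *\<^sub>R y) u = a * J x u + b * J y u) \<and>
     (\<forall>x y. x \<bullet> y = J x (inv_neg_laplace D (J y)))"

definition of_L2 ::
  "'a::euclidean_space set \<Rightarrow> ('h \<Rightarrow> ('a \<Rightarrow> real) \<Rightarrow> real) \<Rightarrow> ('a \<Rightarrow> real) \<Rightarrow> 'h" where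
  "of_L2 D J f = inv J (L2_functional D f)"

definition laplace ::
  "'a::euclidean_space set \<Rightarrow> ('h \<Rightarrow> ('a \<Rightarrow> real) \<Rightarrow> real) \<Rightarrow> ('a \<Rightarrow> real) \<Rightarrow> 'h" where
  "laplace D J u = inv J (laplace_functional D u)"

text \<open>\<open>dens D J x\<close> is a representative of \<open>x \<in> H\<close> as a function, meaningful if \<open>x \<in> L\<^sup>2(D)\<close>.\<close>

definition dens ::
  "'a::euclidean_space set \<Rightarrow> ('h \<Rightarrow> ('a \<Rightarrow> real) \<Rightarrow> real) \<Rightarrow> 'h \<Rightarrow> 'a \<Rightarrow> real" where
  "dens D J x = (SOME f. f \<in> Lsq (lebesgue_on D) \<and> of_L2 D J f = x)"

definition H_Psi ::
  "'a::euclidean_space set \<Rightarrow> ('h \<Rightarrow> ('a \<Rightarrow> real) \<Rightarrow> real) \<Rightarrow> (real \<Rightarrow> real) \<Rightarrow> 'h set" where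
  "H_Psi D J \<Psi> = {x \<in> of_L2 D J ` Lsq (lebesgue_on D). \<Psi> \<circ> dens D J x \<in> H01 D}"

text \<open>
  Eigenfunctions are given by their continuous representatives on \<open>D\<close>, so that suprema over
  \<open>D\<close> of their values make sense.
\<close>

definition is_eigenbasis ::
  "'a::euclidean_space set \<Rightarrow> ('h::{real_inner,complete_space} \<Rightarrow> ('a \<Rightarrow> real) \<Rightarrow> real)
     \<Rightarrow> (nat \<Rightarrow> 'a \<Rightarrow> real) \<Rightarrow> bool" where
  "is_eigenbasis D J e \<longleftrightarrow>
     (\<forall>k. e k \<in> H01 D \<and> continuous_on D (e k) \<and>
        (\<exists>\<mu>. laplace D J (e k) = \<mu> *\<^sub>R of_L2 D J (e k))) \<and>
     (\<forall>i j. of_L2 D J (e i) \<bullet> of_L2 D J (e j) = of_bool (i = j)) \<and>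
     closure (span (range (\<lambda>k. of_L2 D J (e k)))) = UNIV"

text \<open>The operator \<open>A\<close> below is \<open>\<bar>C\<bar> = (C\<^sup>* C)\<^sup>1\<^sup>/\<^sup>2\<close>, whose trace is required to be finite.\<close>

definition trace_class :: "('h::{real_inner,complete_space} \<Rightarrow> 'h) \<Rightarrow> bool" where
  "trace_class C \<longleftrightarrow> bounded_linear C \<and>
     (\<exists>A. bounded_linear A \<and>
        (\<forall>x y. A x \<bullet> y = x \<bullet> A y) \<and> (\<forall>x. 0 \<le> A x \<bullet> x) \<and>
        (\<forall>x y. A x \<bullet> A y = C x \<bullet> C y) \<and>
        (\<forall>B. pairwise orthogonal B \<and> (\<forall>b\<in>B. norm b = 1) \<and> closure (span B) = UNIV
             \<longrightarrow> (\<lambda>b. A b \<bullet> b) summable_on B))"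


section \<open>The operator \<open>N\<^sub>0\<close> and infinitesimally excessive measures\<close>

definition D1 :: "('h::real_normed_vector \<Rightarrow> real) \<Rightarrow> 'h \<Rightarrow> 'h \<Rightarrow>\<^sub>L real" where
  "D1 \<phi> x = Blinfun (frechet_derivative \<phi> (at x))"

definition D2 :: "('h::real_normed_vector \<Rightarrow> real) \<Rightarrow> 'h \<Rightarrow> 'h \<Rightarrow>\<^sub>L 'h \<Rightarrow>\<^sub>L real" where
  "D2 \<phi> x = Blinfun (frechet_derivative (D1 \<phi>) (at x))"

definition Cb2 :: "('h::real_normed_vector \<Rightarrow> real) set" where
  "Cb2 = {\<phi>. (\<forall>x. \<phi> differentiable (at x)) \<and> (\<forall>x. D1 \<phi> differentiable (at x)) \<and>
     continuous_on UNIV (D2 \<phi>) \<and>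
     bounded (range \<phi>) \<and> bounded (range (D1 \<phi>)) \<and> bounded (range (D2 \<phi>))}"

text \<open>
  The drift \<open>\<Delta>(\<Psi>(x))\<close> exists for \<open>x \<in> H_Psi\<close> only; elsewhere it is set to \<open>0\<close>. The operator
  \<open>N\<^sub>0\<close> is used only with measures carried by \<open>H_Psi\<close>, for which this value is irrelevant.
\<close>

definition drift ::
  "'a::euclidean_space set \<Rightarrow> ('h::{real_inner,complete_space} \<Rightarrow> ('a \<Rightarrow> real) \<Rightarrow> real)
     \<Rightarrow> (real \<Rightarrow> real) \<Rightarrow> 'h \<Rightarrow> 'h" where
  "drift D J \<Psi> x = (if x \<in> H_Psi D J \<Psi> then laplace D J (\<Psi> \<circ> dens D J x) else 0)"

definition N0 ::
  "'a::euclidean_space set \<Rightarrow> ('h::{real_inner,complete_space} \<Rightarrow> ('a \<Rightarrow> real) \<Rightarrow> real)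
     \<Rightarrow> (nat \<Rightarrow> 'a \<Rightarrow> real) \<Rightarrow> (nat \<Rightarrow> real) \<Rightarrow> (real \<Rightarrow> real) \<Rightarrow> ('h \<Rightarrow> real) \<Rightarrow> 'h \<Rightarrow> real" where
  "N0 D J e lam \<Psi> \<phi> x =
     1/2 * (\<Sum>k. lam k * D2 \<phi> x (of_L2 D J (e k)) (of_L2 D J (e k))) + D1 \<phi> x (drift D J \<Psi> x)"

text \<open>
  \<open>\<nu>\<close> is infinitesimally excessive with constant \<open>c\<close>. The inner integral is understood to be
  infinite off \<open>H_Psi\<close>; this is the condition that \<open>\<nu>\<close> is carried by \<open>H_Psi\<close>.
\<close>

definition inf_excessive ::
  "'a::euclidean_space set \<Rightarrow> ('h::{real_inner,complete_space} \<Rightarrow> ('a \<Rightarrow> real) \<Rightarrow> real)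
     \<Rightarrow> (nat \<Rightarrow> 'a \<Rightarrow> real) \<Rightarrow> (nat \<Rightarrow> real) \<Rightarrow> (real \<Rightarrow> real) \<Rightarrow> 'h measure \<Rightarrow> real \<Rightarrow> bool" where
  "inf_excessive D J e lam \<Psi> \<nu> c \<longleftrightarrow>
     prob_space \<nu> \<and> sets \<nu> = sets borel \<and>
     (AE x in \<nu>. x \<in> H_Psi D J \<Psi>) \<and>
     (\<integral>\<^sup>+x. (\<integral>\<^sup>+\<xi>. ennreal ((norm (wgrad D (\<Psi> \<circ> dens D J x) \<xi>))\<^sup>2) \<partial>lebesgue_on D) \<partial>\<nu>) < \<infinity> \<and>
     0 < c \<and>
     (\<forall>\<phi>\<in>Cb2. (AE x in \<nu>. 0 \<le> \<phi> x) \<longrightarrow>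
        (\<integral>x. N0 D J e lam \<Psi> \<phi> x \<partial>\<nu>) \<le> c * (\<integral>x. \<phi> x \<partial>\<nu>))"


section \<open>Operators and \<open>C\<^sub>0\<close>-semigroups on \<open>L\<^sup>2\<close>\<close>

text \<open>
  A possibly unbounded operator on \<open>L\<^sup>2(M)\<close> is given by its graph, a set of pairs of functions;
  \<open>Lsq_closure\<close> is the closure of a graph in \<open>L\<^sup>2(M) \<times> L\<^sup>2(M)\<close>.
\<close>

definition Lsq_closure ::
  "'a measure \<Rightarrow> (('a \<Rightarrow> real) \<times> ('a \<Rightarrow> real)) set \<Rightarrow> (('a \<Rightarrow> real) \<times> ('a \<Rightarrow> real)) set" where
  "Lsq_closure M T = {(f, g). \<exists>s :: nat \<Rightarrow> ('a \<Rightarrow> real) \<times> ('a \<Rightarrow> real).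
     (\<forall>n. s n \<in> T) \<and>
     Lsq_tendsto M (\<lambda>n. fst (s n)) f sequentially \<and>
     Lsq_tendsto M (\<lambda>n. snd (s n)) g sequentially}"

definition N2 ::
  "'a::euclidean_space set \<Rightarrow> ('h::{real_inner,complete_space} \<Rightarrow> ('a \<Rightarrow> real) \<Rightarrow> real)
     \<Rightarrow> (nat \<Rightarrow> 'a \<Rightarrow> real) \<Rightarrow> (nat \<Rightarrow> real) \<Rightarrow> (real \<Rightarrow> real) \<Rightarrow> 'h measure
     \<Rightarrow> (('h \<Rightarrow> real) \<times> ('h \<Rightarrow> real)) set" where
  "N2 D J e lam \<Psi> \<nu> = Lsq_closure \<nu> {(\<phi>, N0 D J e lam \<Psi> \<phi>) | \<phi>. \<phi> \<in> Cb2}"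

definition C0_semigroup :: "'a measure \<Rightarrow> (real \<Rightarrow> ('a \<Rightarrow> real) \<Rightarrow> 'a \<Rightarrow> real) \<Rightarrow> bool" where
  "C0_semigroup M P \<longleftrightarrow>
     (\<forall>t\<ge>0. \<forall>f\<in>Lsq M. P t f \<in> Lsq M) \<and>
     (\<forall>t\<ge>0. \<forall>f\<in>Lsq M. \<forall>g\<in>Lsq M. \<forall>a b.
        AE x in M. P t (\<lambda>y. a * f y + b * g y) x = a * P t f x + b * P t g x) \<and>
     (\<forall>t\<ge>0. \<exists>K. \<forall>f\<in>Lsq M. Lsq_norm M (P t f) \<le> K * Lsq_norm M f) \<and>
     (\<forall>f\<in>Lsq M. AE x in M. P 0 f x = f x) \<and>
     (\<forall>s\<ge>0. \<forall>t\<ge>0. \<forall>f\<in>Lsq M. AE x in M. P (s + t) f x = P s (P t f) x) \<and>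
     (\<forall>f\<in>Lsq M. Lsq_tendsto M (\<lambda>t. P t f) f (at_right 0))"

definition generator ::
  "'a measure \<Rightarrow> (real \<Rightarrow> ('a \<Rightarrow> real) \<Rightarrow> 'a \<Rightarrow> real) \<Rightarrow> (('a \<Rightarrow> real) \<times> ('a \<Rightarrow> real)) set" where
  "generator M P = {(f, g). f \<in> Lsq M \<and>
     Lsq_tendsto M (\<lambda>t x. (P t f x - f x) / t) g (at_right 0)}"

text \<open>\<open>v\<close> solves \<open>dv/dt = T v\<close> for \<open>t > 0\<close> with \<open>v(0) = f\<close>, in \<open>L\<^sup>2(M)\<close>.\<close>

definition solves_Cauchy ::
  "'a measure \<Rightarrow> (('a \<Rightarrow> real) \<times> ('a \<Rightarrow> real)) set \<Rightarrow> ('a \<Rightarrow> real)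
     \<Rightarrow> (real \<Rightarrow> 'a \<Rightarrow> real) \<Rightarrow> bool" where
  "solves_Cauchy M T f v \<longleftrightarrow>
     (AE x in M. v 0 x = f x) \<and> Lsq_tendsto M v f (at_right 0) \<and>
     (\<forall>t>0. \<exists>g. (v t, g) \<in> T \<and>
        Lsq_tendsto M (\<lambda>s x. (v s x - v t x) / (s - t)) g (at t))"

end

theory Submission
  imports Defs
begin

text \<open>
  Everything about positivity and growth rests on one inequality. The operator \<open>N\<^sub>0\<close> is a diffusion
  operator, so for \<open>\<beta>\<close> of class \<open>C\<^sup>2\<close> the chain rule reads
  \<open>N\<^sub>0(\<beta> \<circ> \<phi>) = \<beta>'(\<phi>) N\<^sub>0\<phi> + 1/2 \<beta>''(\<phi>) \<Sum>\<^sub>k \<lambda>\<^sub>k (D\<phi>(e\<^sub>k))\<^sup>2\<close> (\<open>N0_comp\<close>). If \<open>\<beta>\<close> is convex, the second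
  term is nonnegative, and if moreover \<open>\<beta> \<ge> 0\<close>, testing the excessiveness of \<open>\<nu>\<close> with \<open>\<beta> \<circ> \<phi>\<close> gives
  \<open>\<integral> \<beta>'(\<phi>) N\<^sub>0\<phi> d\<nu> \<le> \<lambda>\<^sub>\<nu> \<integral> \<beta>(\<phi>) d\<nu>\<close>. When \<open>\<beta>\<close> and \<open>\<beta>'\<close> are Lipschitz, both sides are continuous in
  \<open>L\<^sup>2(\<nu>)\<close>, so the inequality passes to the closure \<open>N\<^sub>2\<close> (\<open>N2_convex_integral_le\<close>).

  For \<open>f\<close> in the domain of \<open>N\<^sub>2\<close> the left-hand side, taken at \<open>P\<^sub>t f\<close>, is the time derivative of
  \<open>\<integral> \<beta>(P\<^sub>t f) d\<nu>\<close>. Gronwall's lemma gives \<open>\<integral> \<beta>(P\<^sub>t f) d\<nu> \<le> exp(\<lambda>\<^sub>\<nu> t) \<integral> \<beta>(f) d\<nu>\<close>, first on the domain,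
  then by density on all of \<open>L\<^sup>2(\<nu>)\<close> (\<open>semigroup_convex_integral_growth\<close>). With
  \<open>\<beta>(s) = sqrt (s\<^sup>2 + \<epsilon>\<^sup>2) + a s\<close>, \<open>\<bar>a\<bar> \<le> 1\<close>, and \<open>\<epsilon> \<rightarrow> 0\<close> this becomes
  \<open>\<integral> (\<bar>P\<^sub>t f\<bar> + a P\<^sub>t f) d\<nu> \<le> exp(\<lambda>\<^sub>\<nu> t) \<integral> (\<bar>f\<bar> + a f) d\<nu>\<close>. Since \<open>\<bar>s\<bar> - s\<close> vanishes exactly for \<open>s \<ge> 0\<close>,
  the choice \<open>a = -1\<close> shows that \<open>P\<^sub>t\<close> preserves positivity, and \<open>a = 0\<close> is the bound in (iii).
  Finally \<open>P\<^sub>t 1 = 1\<close> because \<open>N\<^sub>0 1 = 0\<close>.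

  The argument uses three facts on \<open>C\<^sub>0\<close>-semigroups: their orbits are continuous, an orbit starting
  in the domain is differentiable from both sides with derivative \<open>P\<^sub>t N\<^sub>2 f\<close> (which is (i)), and the
  domain is dense. They are proved for semigroups on a closed subspace of a Banach space; local
  boundedness comes from Banach-Steinhaus and density from averages of orbits. To apply them,
  \<open>L\<^sup>2(\<nu>)\<close> is embedded isometrically as a closed subspace of a space of bounded functions.
\<close>

section \<open>Bounded operators on closed subspaces of a Banach space\<close>

text \<open>
  Riemann sums of \<open>f\<close> are linear combinations of values of \<open>f\<close>, and the integral is their limit.
\<close>

lemma closed_subspace_integral_mem:
  fixes f :: "real \<Rightarrow> 'b::banach"
  assumes "subspace S" "closed S" "a \<le> b" "continuous_on {a..b} f"
    and mem: "\<And>t. t \<in> {a..b} \<Longrightarrow> f t \<in> S"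
  shows "integral {a..b} f \<in> S"
proof -
  have hi: "(f has_integral integral {a..b} f) {a..b}"
    using assms(4) integrable_continuous_real by blast
  have "\<exists>y\<in>S. dist y (integral {a..b} f) < \<epsilon>" if pos: "\<epsilon> > 0" for \<epsilon>
  proof -
    obtain \<gamma> where \<gamma>: "gauge \<gamma>" and
      close: "\<forall>\<D>. \<D> tagged_division_of {a..b} \<and> \<gamma> fine \<D> \<longrightarrow>
         norm ((\<Sum>(x,k)\<in>\<D>. measure lborel k *\<^sub>R f x) - integral {a..b} f) < \<epsilon>"
      using iffD1[OF has_integral_real hi, rule_format, OF pos] by (elim exE conjE)
    obtain p where p: "p tagged_division_of {a..b}" "\<gamma> fine p"
      by (rule fine_division_exists_real[OF \<gamma>, of a b])
    have "(\<Sum>(x,k)\<in>p. measure lborel k *\<^sub>R f x) \<in> S"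
    proof (rule subspace_sum[OF assms(1)])
      fix z assume "z \<in> p"
      then obtain x k where z: "z = (x, k)" "(x, k) \<in> p" by (cases z) auto
      then have "x \<in> {a..b}" using tag_in_interval[OF p(1)] by blast
      then show "(case z of (x, k) \<Rightarrow> measure lborel k *\<^sub>R f x) \<in> S"
        using z mem subspace_scale[OF assms(1)] by auto
    qed
    then show ?thesis using close p unfolding dist_norm by blast
  qed
  then show ?thesis
    using closed_approachable[OF assms(2)] by blast
qed

lemma bounded_linear_on_subspace_continuous:
  fixes A :: "'b::real_normed_vector \<Rightarrow> 'c::real_normed_vector"
  assumes V: "subspace V"
    and lin: "\<And>x y a b. x \<in> V \<Longrightarrow> y \<in> V \<Longrightarrow> A (a *\<^sub>R x + b *\<^sub>R y) = a *\<^sub>R A x + b *\<^sub>R A y"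
    and bdd: "\<exists>K. \<forall>x\<in>V. norm (A x) \<le> K * norm x"
  shows "continuous_on V A"
proof -
  obtain K where K: "\<And>x. x \<in> V \<Longrightarrow> norm (A x) \<le> K * norm x" using bdd by blast
  have "(\<bar>K\<bar>)-lipschitz_on V A"
  proof (rule lipschitz_onI)
    fix x y assume xy: "x \<in> V" "y \<in> V"
    have "norm (A (x - y)) \<le> K * norm (x - y)" using K subspace_diff[OF V] xy by blast
    also have "\<dots> \<le> \<bar>K\<bar> * norm (x - y)" by (simp add: mult_right_mono)
    finally show "dist (A x) (A y) \<le> \<bar>K\<bar> * dist x y"
      using lin[OF xy, of 1 "-1"] by (simp add: dist_norm)
  qed simp
  then show ?thesis by (rule lipschitz_on_continuous_on)
qed

text \<open>
  The operator \<open>A\<close> is linear and bounded on \<open>V\<close> only. Its graph over \<open>V\<close> is a closed subspace of the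
  product space that contains \<open>(f t, A (f t))\<close>, hence also the integral of this pair.
\<close>

lemma bounded_linear_on_subspace_integral:
  fixes A :: "'b::banach \<Rightarrow> 'b" and f :: "real \<Rightarrow> 'b"
  assumes V: "subspace V" "closed V"
    and lin: "\<And>x y a b. x \<in> V \<Longrightarrow> y \<in> V \<Longrightarrow> A (a *\<^sub>R x + b *\<^sub>R y) = a *\<^sub>R A x + b *\<^sub>R A y"
    and bdd: "\<exists>K. \<forall>x\<in>V. norm (A x) \<le> K * norm x"
    and f: "a \<le> b" "continuous_on {a..b} f" "\<And>t. t \<in> {a..b} \<Longrightarrow> f t \<in> V"
  shows "A (integral {a..b} f) = integral {a..b} (\<lambda>t. A (f t))"
proof -
  define G where "G = (\<lambda>x. (x, A x)) ` V"
  have contA: "continuous_on V A"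
    by (rule bounded_linear_on_subspace_continuous[OF V(1) lin bdd])
  have cA: "continuous_on {a..b} (\<lambda>t. A (f t))"
    by (rule continuous_on_compose2[OF contA f(2)]) (use f(3) in blast)
  have "subspace G"
    unfolding subspace_def
  proof (intro conjI ballI allI)
    have memG: "(x, y) \<in> G \<longleftrightarrow> x \<in> V \<and> y = A x" for x y unfolding G_def by auto
    show "0 \<in> G"
      using subspace_0[OF V(1)] lin[of 0 0 0 0] by (simp add: zero_prod_def memG)
    show "p + q \<in> G" if "p \<in> G" "q \<in> G" for p q
      using that lin[of "fst p" "fst q" 1 1] subspace_add[OF V(1)]
      by (cases p; cases q) (simp add: memG)
    show "c *\<^sub>R p \<in> G" if "p \<in> G" for c p
      using that lin[of "fst p" "fst p" c 0] subspace_scale[OF V(1)]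
      by (cases p) (simp add: memG)
  qed
  moreover have "closed G"
    unfolding G_def by (rule continuous_closed_graph[OF V(2) contA])
  ultimately have "integral {a..b} (\<lambda>t. (f t, A (f t))) \<in> G"
    by (rule closed_subspace_integral_mem) (use f cA in \<open>auto simp: G_def intro: continuous_on_Pair\<close>)
  moreover have int: "(\<lambda>t. (f t, A (f t))) integrable_on {a..b}"
    by (intro integrable_continuous_real continuous_on_Pair f(2) cA)
  have "integral {a..b} (\<lambda>t. (f t, A (f t))) = (integral {a..b} f, integral {a..b} (\<lambda>t. A (f t)))"
    using integral_linear[OF int bounded_linear_fst] integral_linear[OF int bounded_linear_snd]
    by (simp add: o_def prod_eq_iff)
  ultimately show ?thesis unfolding G_def by auto
qed

lemma has_vector_derivative_iff_quotient_tendsto: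
  "(f has_vector_derivative y) (at t within S) \<longleftrightarrow>
    ((\<lambda>s. (1 / (s - t)) *\<^sub>R (f s - f t)) \<longlongrightarrow> y) (at t within S)"
proof -
  have "((\<lambda>s. norm ((f s - f t) - (s - t) *\<^sub>R y) / norm (s - t)) \<longlongrightarrow> 0) (at t within S) \<longleftrightarrow>
    ((\<lambda>s. norm ((1 / (s - t)) *\<^sub>R (f s - f t) - y)) \<longlongrightarrow> 0) (at t within S)"
  proof (intro filterlim_cong refl)
    have "norm ((f s - f t) - (s - t) *\<^sub>R y) / norm (s - t) = norm ((1 / (s - t)) *\<^sub>R (f s - f t) - y)"
      if "s \<noteq> t" for s
    proof -
      have "(1 / (s - t)) *\<^sub>R (f s - f t) - y = (1 / (s - t)) *\<^sub>R ((f s - f t) - (s - t) *\<^sub>R y)"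
        using that by (simp add: scaleR_diff_right)
      then show ?thesis by simp
    qed
    then show "\<forall>\<^sub>F s in at t within S. norm ((f s - f t) - (s - t) *\<^sub>R y) / norm (s - t)
        = norm ((1 / (s - t)) *\<^sub>R (f s - f t) - y)"
      by (auto simp: eventually_at_filter)
  qed
  then show ?thesis
    unfolding has_vector_derivative_def has_derivative_iff_norm tendsto_norm_zero_iff
    by (simp add: bounded_linear_scaleR_left LIM_zero_iff)
qed

text \<open>
  The Banach-Steinhaus theorem for operators on a closed subspace. By Baire's theorem one of the
  closed sets \<open>F k = {x \<in> V. \<forall>n. norm (A n x) \<le> k}\<close>, which cover \<open>V\<close>, contains a ball of \<open>V\<close>.
\<close>

lemma uniform_boundedness_closed_subspace:
  fixes A :: "nat \<Rightarrow> 'b::banach \<Rightarrow> 'c::real_normed_vector"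
  assumes V: "subspace V" "closed V"
    and lin: "\<And>n x y a b. x \<in> V \<Longrightarrow> y \<in> V \<Longrightarrow> A n (a *\<^sub>R x + b *\<^sub>R y) = a *\<^sub>R A n x + b *\<^sub>R A n y"
    and bdd: "\<And>n. \<exists>K. \<forall>x\<in>V. norm (A n x) \<le> K * norm x"
    and pointwise: "\<And>x. x \<in> V \<Longrightarrow> bounded (range (\<lambda>n. A n x))"
  obtains K where "\<And>n x. x \<in> V \<Longrightarrow> norm (A n x) \<le> K * norm x"
proof -
  define F where "F k = {x \<in> V. \<forall>n. norm (A n x) \<le> real k}" for k :: nat
  have diff: "A n (x - y) = A n x - A n y" if "x \<in> V" "y \<in> V" for n x y
    using lin[OF that, of n 1 "-1"] by simp
  have cont: "continuous_on V (A n)" for n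
    using bounded_linear_on_subspace_continuous[OF V(1) lin bdd] by blast
  have closedF: "closedin (top_of_set V) (F k)" for k
  proof -
    have "F k = (\<Inter>n. V \<inter> A n -` cball 0 (real k))"
      unfolding F_def by auto
    moreover have "closedin (top_of_set V) (V \<inter> A n -` cball 0 (real k))" for n
      by (rule continuous_closedin_preimage[OF cont]) simp
    ultimately show ?thesis by (metis (no_types, lifting) closedin_INT UNIV_not_empty)
  qed
  have cover: "\<Union>(range F) = V"
  proof
    show "V \<subseteq> \<Union>(range F)"
    proof
      fix x assume x: "x \<in> V"
      obtain c where c: "\<And>n. norm (A n x) \<le> c"
        using pointwise[OF x] unfolding bounded_iff by auto
      obtain k where "c \<le> real k" using real_arch_simple by blast
      then have "x \<in> F k" unfolding F_def using x c order_trans by blast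
      then show "x \<in> \<Union>(range F)" by blast
    qed
  qed (auto simp: F_def)
  have "completely_metrizable_space (top_of_set V)"
    using completely_metrizable_space_closedin[OF completely_metrizable_space_euclidean] V(2) by auto
  moreover have "top_of_set V interior_of \<Union>(range F) \<noteq> {}"
    using cover subspace_0[OF V(1)]
    by (metis empty_iff interior_of_topspace topspace_euclidean_subtopology)
  ultimately obtain k where "top_of_set V interior_of F k \<noteq> {}"
    using Baire_category_alt[of "top_of_set V" "range F"] closedF by force
  then obtain x0 U where U: "openin (top_of_set V) U" "x0 \<in> U" "U \<subseteq> F k"
    unfolding interior_of_def by blast
  then obtain \<epsilon> where \<epsilon>: "\<epsilon> > 0" "\<And>y. y \<in> V \<Longrightarrow> dist y x0 < \<epsilon> \<Longrightarrow> y \<in> F k"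
    unfolding openin_euclidean_subtopology_iff by blast
  have x0: "x0 \<in> F k" "x0 \<in> V" using U unfolding F_def by auto
  have "norm (A n x) \<le> (4 * real k / \<epsilon>) * norm x" if x: "x \<in> V" for n x
  proof (cases "x = 0")
    case True
    then show ?thesis using lin[of 0 0 n 0 0] subspace_0[OF V(1)] by simp
  next
    case False
    \<comment> \<open>This scaling puts \<open>x0 + c x\<close> into the ball of radius \<open>\<epsilon>\<close> around \<open>x0\<close>.\<close>
    define c where "c = \<epsilon> / (2 * norm x)"
    have c: "c > 0" using \<epsilon> False by (simp add: c_def)
    have "x0 + c *\<^sub>R x \<in> V" using x0 x V(1) by (simp add: subspace_add subspace_scale)
    moreover have "dist (x0 + c *\<^sub>R x) x0 < \<epsilon>"
      using False \<epsilon> by (simp add: dist_norm c_def)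
    ultimately have y: "norm (A n (x0 + c *\<^sub>R x)) \<le> k" using \<epsilon> unfolding F_def by auto
    have "A n (x0 + c *\<^sub>R x) = A n x0 + c *\<^sub>R A n x" using lin[of x0 x n 1 c] x0 x by simp
    then have "c *\<^sub>R A n x = A n (x0 + c *\<^sub>R x) - A n x0" by simp
    then have "norm (c *\<^sub>R A n x) \<le> norm (A n (x0 + c *\<^sub>R x)) + norm (A n x0)"
      using norm_triangle_ineq4 by metis
    also have "\<dots> \<le> 2 * real k" using add_mono[OF y, of "norm (A n x0)" "real k"] x0 unfolding F_def by auto
    finally have "c * norm (A n x) \<le> 2 * real k" using c by simp
    then have "norm (A n x) \<le> 2 * real k / c"
      using c by (simp add: field_simps)
    also have "\<dots> = (4 * real k / \<epsilon>) * norm x"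
      unfolding c_def by simp
    finally show ?thesis .
  qed
  then show thesis by (rule that)
qed

section \<open>Strongly continuous semigroups on a closed subspace\<close>

text \<open>
  A \<open>C\<^sub>0\<close>-semigroup on the Banach space \<open>V\<close>. It is carried by a subspace and not by a type because the
  space \<open>L\<^sup>2(M)\<close> depends on the measure \<open>M\<close>.
\<close>

locale subspace_semigroup =
  fixes V :: "'b::banach set" and T :: "real \<Rightarrow> 'b \<Rightarrow> 'b"
  assumes subspace_V: "subspace V" and closed_V: "closed V"
    and maps: "t \<ge> 0 \<Longrightarrow> x \<in> V \<Longrightarrow> T t x \<in> V"
    and lin: "t \<ge> 0 \<Longrightarrow> x \<in> V \<Longrightarrow> y \<in> V \<Longrightarrow> T t (a *\<^sub>R x + b *\<^sub>R y) = a *\<^sub>R T t x + b *\<^sub>R T t y"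
    and bdd: "t \<ge> 0 \<Longrightarrow> \<exists>K. \<forall>x\<in>V. norm (T t x) \<le> K * norm x"
    and at_0: "x \<in> V \<Longrightarrow> T 0 x = x"
    and add: "s \<ge> 0 \<Longrightarrow> t \<ge> 0 \<Longrightarrow> x \<in> V \<Longrightarrow> T (s + t) x = T s (T t x)"
    and cont_0: "x \<in> V \<Longrightarrow> ((\<lambda>t. T t x) \<longlongrightarrow> x) (at_right 0)"
begin

lemma diff: "t \<ge> 0 \<Longrightarrow> x \<in> V \<Longrightarrow> y \<in> V \<Longrightarrow> T t (x - y) = T t x - T t y"
  using lin[of t x y 1 "-1"] by simp

lemma scale: "t \<ge> 0 \<Longrightarrow> x \<in> V \<Longrightarrow> T t (a *\<^sub>R x) = a *\<^sub>R T t x"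
  using lin[of t x x a 0] by simp

lemma zero: "t \<ge> 0 \<Longrightarrow> T t 0 = 0"
  using scale[of t 0 0] subspace_0[OF subspace_V] by simp

text \<open>
  Otherwise there are times \<open>s n \<rightarrow> 0\<close> at which the norms of the operators exceed \<open>n\<close>. But \<open>T (s n) x \<rightarrow> x\<close>
  for every \<open>x\<close>, so these operators are bounded pointwise, which contradicts Banach-Steinhaus.
\<close>

lemma bounded_near_0:
  obtains \<delta> K where "\<delta> > 0" "\<And>t x. 0 \<le> t \<Longrightarrow> t \<le> \<delta> \<Longrightarrow> x \<in> V \<Longrightarrow> norm (T t x) \<le> K * norm x"
proof (rule ccontr)
  assume neg: "\<not> thesis"
  have "\<exists>t x. 0 \<le> t \<and> t \<le> 1 / Suc n \<and> x \<in> V \<and> norm (T t x) > real n * norm x" for n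
  proof (rule ccontr)
    assume "\<not> ?thesis"
    then have "\<And>t x. 0 \<le> t \<Longrightarrow> t \<le> 1 / Suc n \<Longrightarrow> x \<in> V \<Longrightarrow> norm (T t x) \<le> real n * norm x"
      by force
    then show False using that[of "1 / Suc n" "real n"] neg by simp
  qed
  then obtain s y where sy: "\<And>n. 0 \<le> s n \<and> s n \<le> 1 / Suc n \<and> y n \<in> V \<and>
      norm (T (s n) (y n)) > real n * norm (y n)" by metis
  have s0: "s \<longlonglongrightarrow> 0"
  proof (rule tendsto_sandwich[OF _ _ tendsto_const LIMSEQ_inverse_real_of_nat])
    show "\<forall>\<^sub>F n in sequentially. 0 \<le> s n"
      by (intro always_eventually allI) (use sy in blast)
    show "\<forall>\<^sub>F n in sequentially. s n \<le> inverse (real (Suc n))"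
      unfolding inverse_eq_divide by (intro always_eventually allI) (use sy in blast)
  qed
  have "bounded (range (\<lambda>n. T (s n) x))" if x: "x \<in> V" for x
  proof -
    have "(\<lambda>n. T (s n) x) \<longlonglongrightarrow> T 0 x"
    proof (rule tendstoI)
      fix \<epsilon> :: real assume \<epsilon>: "\<epsilon> > 0"
      then obtain d where d: "d > 0" "\<And>t. 0 < t \<Longrightarrow> t < d \<Longrightarrow> dist (T t x) x < \<epsilon>"
        using tendstoD[OF cont_0[OF x] \<epsilon>] unfolding eventually_at_right_field by blast
      have "\<forall>\<^sub>F n in sequentially. s n < d" using s0 d(1) by (rule order_tendstoD)
      then show "\<forall>\<^sub>F n in sequentially. dist (T (s n) x) (T 0 x) < \<epsilon>"
      proof eventually_elim
        case (elim n)
        then show ?case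
          using d(2)[of "s n"] sy[of n] at_0[OF x] \<epsilon> by (cases "s n = 0") auto
      qed
    qed
    then show ?thesis by (simp add: convergent_imp_bounded)
  qed
  moreover have "\<exists>K. \<forall>x\<in>V. norm (T (s n) x) \<le> K * norm x" for n
    using bdd sy by blast
  ultimately obtain K where K: "\<And>n x. x \<in> V \<Longrightarrow> norm (T (s n) x) \<le> K * norm x"
    using uniform_boundedness_closed_subspace[OF subspace_V closed_V, of "\<lambda>n. T (s n)" thesis,
        OF lin[OF conjunct1[OF sy]]]
    by blast
  obtain n where n: "K \<le> real n" using real_arch_simple by blast
  have "norm (T (s n) (y n)) \<le> real n * norm (y n)"
    using K[of "y n" n] sy[of n] mult_right_mono[OF n, of "norm (y n)"] by simp
  then show False using sy[of n] by linarith
qed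

lemma bounded_on_interval:
  obtains K where "K \<ge> 0" "\<And>t x. 0 \<le> t \<Longrightarrow> t \<le> b \<Longrightarrow> x \<in> V \<Longrightarrow> norm (T t x) \<le> K * norm x"
proof -
  obtain \<delta> K where \<delta>: "\<delta> > 0"
    and K0: "\<And>t x. 0 \<le> t \<Longrightarrow> t \<le> \<delta> \<Longrightarrow> x \<in> V \<Longrightarrow> norm (T t x) \<le> K * norm x"
    by (rule bounded_near_0) blast
  define M where "M = max K 1"
  have M: "M \<ge> 1" by (simp add: M_def)
  have KM: "norm (T t x) \<le> M * norm x" if "0 \<le> t" "t \<le> \<delta>" "x \<in> V" for t x
  proof -
    have "K * norm x \<le> M * norm x" unfolding M_def by (intro mult_right_mono) auto
    then show ?thesis using K0[OF that] by linarith
  qed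
  have *: "norm (T t x) \<le> M ^ n * norm x" if "0 \<le> t" "t \<le> real n * \<delta>" "x \<in> V" for n t x
    using that
  proof (induction n arbitrary: t)
    case 0
    then show ?case using at_0 by simp
  next
    case (Suc n)
    show ?case
    proof (cases "t \<le> \<delta>")
      case True
      have "norm (T t x) \<le> M * norm x" using KM Suc.prems True by blast
      also have "\<dots> \<le> M ^ Suc n * norm x"
        using M by (intro mult_right_mono) (auto simp: one_le_power)
      finally show ?thesis .
    next
      case False
      have "T t x = T \<delta> (T (t - \<delta>) x)" using add[of \<delta> "t - \<delta>" x] \<delta> False Suc.prems by simp
      moreover have "norm (T \<delta> (T (t - \<delta>) x)) \<le> M * norm (T (t - \<delta>) x)"
        using KM[of \<delta>] maps[of "t - \<delta>" x] \<delta> False Suc.prems by simp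
      moreover have "norm (T (t - \<delta>) x) \<le> M ^ n * norm x"
        using Suc.IH[of "t - \<delta>"] Suc.prems False by (simp add: algebra_simps)
      ultimately show ?thesis
        using order_trans[OF _ mult_left_mono, of _ M "norm (T (t - \<delta>) x)" "M ^ n * norm x"] M
        unfolding power_Suc mult.assoc by simp
    qed
  qed
  obtain n where "b / \<delta> \<le> real n" using real_arch_simple by blast
  then have "b \<le> real n * \<delta>" using \<delta> by (simp add: field_simps)
  then show thesis using that[of "M ^ n"] * M by force
qed

lemma abs_diff_tendsto_0:
  assumes "t \<ge> (0::real)"
  shows "filterlim (\<lambda>s. \<bar>s - t\<bar>) (at_right 0) (at t within {0..})"
  unfolding filterlim_at
proof
  show "((\<lambda>s. \<bar>s - t\<bar>) \<longlongrightarrow> 0) (at t within {0..})"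
    by (rule tendsto_eq_intros refl | simp)+
  show "\<forall>\<^sub>F s in at t within {0..}. \<bar>s - t\<bar> \<in> {0<..} \<and> \<bar>s - t\<bar> \<noteq> 0"
    by (auto simp: eventually_at_filter)
qed

text \<open>
  Factoring out the semigroup at the earlier of the two times reduces increments of an orbit at any
  time, in both directions, to increments at time \<open>0\<close>. This is how one-sided statements at \<open>0\<close> become
  two-sided ones.
\<close>

lemma orbit_diff:
  assumes "s \<ge> 0" "t \<ge> 0" "x \<in> V"
  shows "T s x - T t x = (if t \<le> s then 1 else -1) *\<^sub>R T (min s t) (T \<bar>s - t\<bar> x - x)"
  using assms add[of t "s - t" x] add[of s "t - s" x] diff[of s "T (t - s) x" x]
    diff[of t "T (s - t) x" x] maps
  by (auto simp: min_def)

lemma orbit_tendsto: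
  assumes t: "t \<ge> 0" and x: "x \<in> V"
  shows "((\<lambda>s. T s x) \<longlongrightarrow> T t x) (at t within {0..})"
proof -
  obtain K where K: "K \<ge> 0" "\<And>s x. 0 \<le> s \<Longrightarrow> s \<le> t \<Longrightarrow> x \<in> V \<Longrightarrow> norm (T s x) \<le> K * norm x"
    using bounded_on_interval[of t] by blast
  have "((\<lambda>s. T \<bar>s - t\<bar> x) \<longlongrightarrow> x) (at t within {0..})"
    by (rule filterlim_compose[OF cont_0[OF x] abs_diff_tendsto_0[OF t]])
  then have "((\<lambda>s. K * norm (T \<bar>s - t\<bar> x - x)) \<longlongrightarrow> 0) (at t within {0..})"
    using LIM_zero tendsto_mult_right_zero tendsto_norm_zero by blast
  moreover have "\<forall>\<^sub>F s in at t within {0..}. norm (T s x - T t x) \<le> K * norm (T \<bar>s - t\<bar> x - x)"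
    unfolding eventually_at_filter
  proof (intro always_eventually allI impI)
    fix s :: real assume s: "s \<in> {0..}"
    then have "T \<bar>s - t\<bar> x - x \<in> V" using maps x subspace_diff[OF subspace_V] by auto
    then show "norm (T s x - T t x) \<le> K * norm (T \<bar>s - t\<bar> x - x)"
      using orbit_diff[of s t x] s t x K(2)[of "min s t"] by auto
  qed
  ultimately have "((\<lambda>s. T s x - T t x) \<longlongrightarrow> 0) (at t within {0..})"
    by (rule Lim_null_comparison[rotated])
  then show ?thesis by (rule LIM_zero_cancel)
qed

lemma orbit_continuous_on: "x \<in> V \<Longrightarrow> continuous_on {0..} (\<lambda>s. T s x)"
  unfolding continuous_on_def using orbit_tendsto by auto

definition generator_maps :: "'b \<Rightarrow> 'b \<Rightarrow> bool" where
  "generator_maps x y \<longleftrightarrow> x \<in> V \<and> y \<in> V \<and> ((\<lambda>t. (1 / t) *\<^sub>R (T t x - x)) \<longlongrightarrow> y) (at_right 0)"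

text \<open>
  With \<open>m = min s t\<close> and \<open>q\<close> the difference quotient at \<open>0\<close>, the quotient of the orbit between \<open>s\<close> and \<open>t\<close>
  is \<open>T m (q \<bar>s - t\<bar>)\<close>. Local boundedness of the semigroup controls its distance to \<open>T m y\<close>, and \<open>T m y\<close>
  tends to \<open>T t y\<close> by continuity of orbits.
\<close>

lemma orbit_has_derivative:
  assumes g: "generator_maps x y" and t: "t \<ge> 0"
  shows "((\<lambda>s. T s x) has_vector_derivative T t y) (at t within {0..})"
proof -
  define q where "q h = (1 / h) *\<^sub>R (T h x - x)" for h
  have x: "x \<in> V" and y: "y \<in> V" and q: "(q \<longlongrightarrow> y) (at_right 0)"
    using g unfolding generator_maps_def q_def by auto
  obtain K where K: "K \<ge> 0" "\<And>s x. 0 \<le> s \<Longrightarrow> s \<le> t \<Longrightarrow> x \<in> V \<Longrightarrow> norm (T s x) \<le> K * norm x"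
    using bounded_on_interval[of t] by blast
  have "((\<lambda>s. norm (q \<bar>s - t\<bar> - y)) \<longlongrightarrow> 0) (at t within {0..})"
    by (intro tendsto_norm_zero LIM_zero filterlim_compose[OF q abs_diff_tendsto_0[OF t]])
  moreover have "((\<lambda>s. norm (T s y - T t y)) \<longlongrightarrow> 0) (at t within {0..})"
    by (intro tendsto_norm_zero LIM_zero orbit_tendsto t y)
  ultimately have "((\<lambda>s. K * norm (q \<bar>s - t\<bar> - y) + norm (T s y - T t y)) \<longlongrightarrow> 0) (at t within {0..})"
    using tendsto_add_zero tendsto_mult_right_zero by blast
  moreover have "\<forall>\<^sub>F s in at t within {0..}.
      norm ((1 / (s - t)) *\<^sub>R (T s x - T t x) - T t y) \<le> K * norm (q \<bar>s - t\<bar> - y) + norm (T s y - T t y)"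
    unfolding eventually_at_filter
  proof (intro always_eventually allI impI)
    fix s :: real assume s: "s \<in> {0..}" and st: "s \<noteq> t"
    define m where "m = min s t"
    have m: "0 \<le> m" "m \<le> t" using s t by (auto simp: m_def)
    have h: "T \<bar>s - t\<bar> x - x \<in> V" using maps x subspace_diff[OF subspace_V] by auto
    then have qV: "q \<bar>s - t\<bar> \<in> V" unfolding q_def using subspace_scale[OF subspace_V] by blast
    have "(1 / (s - t)) *\<^sub>R (T s x - T t x) = (1 / \<bar>s - t\<bar>) *\<^sub>R T m (T \<bar>s - t\<bar> x - x)"
    proof (cases "t \<le> s")
      case False
      then have "1 / (s - t) = - (1 / \<bar>s - t\<bar>)" using minus_divide_right[of 1 "s - t"] by simp
      then show ?thesis using orbit_diff[of s t x] s t x False by (simp add: m_def)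
    qed (use orbit_diff[of s t x] s t x in \<open>simp add: m_def\<close>)
    also have "\<dots> = T m (q \<bar>s - t\<bar>)" unfolding q_def using scale[OF m(1) h] by simp
    also have "\<dots> = T m (q \<bar>s - t\<bar> - y) + T m y" using diff[OF m(1) qV y] by simp
    finally have eq: "(1 / (s - t)) *\<^sub>R (T s x - T t x) - T t y
        = T m (q \<bar>s - t\<bar> - y) + (T m y - T t y)" by simp
    have "norm (T m (q \<bar>s - t\<bar> - y)) \<le> K * norm (q \<bar>s - t\<bar> - y)"
      using K(2)[OF m] qV y subspace_diff[OF subspace_V] by blast
    moreover have "norm (T m y - T t y) \<le> norm (T s y - T t y)" by (auto simp: m_def min_def)
    ultimately show "norm ((1 / (s - t)) *\<^sub>R (T s x - T t x) - T t y)
        \<le> K * norm (q \<bar>s - t\<bar> - y) + norm (T s y - T t y)"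
      unfolding eq using norm_triangle_ineq[of "T m (q \<bar>s - t\<bar> - y)" "T m y - T t y"] by linarith
  qed
  ultimately have "((\<lambda>s. (1 / (s - t)) *\<^sub>R (T s x - T t x) - T t y) \<longlongrightarrow> 0) (at t within {0..})"
    by (rule Lim_null_comparison[rotated])
  then have "((\<lambda>s. (1 / (s - t)) *\<^sub>R (T s x - T t x)) \<longlongrightarrow> T t y) (at t within {0..})"
    by (rule LIM_zero_cancel)
  then show ?thesis by (simp only: has_vector_derivative_iff_quotient_tendsto)
qed

lemma generator_maps_orbit:
  assumes g: "generator_maps x y" and t: "t \<ge> 0"
  shows "generator_maps (T t x) (T t y)"
proof -
  have x: "x \<in> V" and y: "y \<in> V" using g unfolding generator_maps_def by auto
  have "((\<lambda>h. (1 / (t + h - t)) *\<^sub>R (T (t + h) x - T t x)) \<longlongrightarrow> T t y) (at_right 0)"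
  proof (rule filterlim_compose[where f = "\<lambda>h. t + h" and g = "\<lambda>s. (1 / (s - t)) *\<^sub>R (T s x - T t x)"])
    show "((\<lambda>s. (1 / (s - t)) *\<^sub>R (T s x - T t x)) \<longlongrightarrow> T t y) (at t within {0..})"
      using orbit_has_derivative[OF g t] by (simp only: has_vector_derivative_iff_quotient_tendsto)
    show "filterlim (\<lambda>h. t + h) (at t within {0..}) (at_right 0)"
      unfolding filterlim_at using t
      by (auto intro!: tendsto_eq_intros simp: eventually_at_filter)
  qed
  then have "((\<lambda>h. (1 / h) *\<^sub>R (T (t + h) x - T t x)) \<longlongrightarrow> T t y) (at_right 0)" by simp
  moreover have "\<forall>\<^sub>F h in at_right 0. (1 / h) *\<^sub>R (T (t + h) x - T t x)
      = (1 / h) *\<^sub>R (T h (T t x) - T t x)"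
    unfolding eventually_at_filter
    by (intro always_eventually allI impI) (use add[of _ t x] t x in \<open>simp add: add.commute\<close>)
  ultimately have "((\<lambda>h. (1 / h) *\<^sub>R (T h (T t x) - T t x)) \<longlongrightarrow> T t y) (at_right 0)"
    using tendsto_cong by fast
  then show ?thesis unfolding generator_maps_def using maps t x y by blast
qed

text \<open>
  The averages \<open>(1/h) \<integral>\<^sub>0\<^sup>h T s x ds\<close> tend to \<open>x\<close> as \<open>h \<rightarrow> 0\<close>. They lie in the domain of the generator
  because \<open>T \<delta>\<close> shifts the interval of integration, so that only two short pieces at its ends
  contribute to the difference quotient.
\<close>

lemma gen_domain_dense:
  assumes x: "x \<in> V" and \<epsilon>: "\<epsilon> > 0"
  obtains z y where "generator_maps z y" "norm (z - x) < \<epsilon>"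
proof -
  have ion: "(\<lambda>s. T s x) integrable_on {a..b}" if "0 \<le> a" for a b
    by (intro integrable_continuous_real continuous_on_subset[OF orbit_continuous_on[OF x]])
       (use that in auto)
  define I where "I h = integral {0..h} (\<lambda>s. T s x)" for h
  have IV: "I h \<in> V" if "0 \<le> h" for h
    unfolding I_def
    by (rule closed_subspace_integral_mem[OF subspace_V closed_V that])
       (auto intro: continuous_on_subset[OF orbit_continuous_on[OF x]] maps x)
  have dI: "(I has_vector_derivative T t x) (at t within {0..b})" if "0 \<le> t" "t \<le> b" for t b
    unfolding I_def
    by (rule integral_has_vector_derivative) (use that in \<open>auto intro: continuous_on_subset[OF orbit_continuous_on[OF x]]\<close>)
  have lim: "((\<lambda>h. (1 / h) *\<^sub>R (I (t + h) - I t)) \<longlongrightarrow> T t x) (at_right 0)" if t: "0 \<le> t" for t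
  proof -
    have "((\<lambda>h. (1 / (t + h - t)) *\<^sub>R (I (t + h) - I t)) \<longlongrightarrow> T t x) (at_right 0)"
    proof (rule filterlim_compose[where f = "\<lambda>h. t + h" and g = "\<lambda>s. (1 / (s - t)) *\<^sub>R (I s - I t)"])
      show "((\<lambda>s. (1 / (s - t)) *\<^sub>R (I s - I t)) \<longlongrightarrow> T t x) (at t within {0..t+1})"
        using dI[of t "t+1"] t unfolding has_vector_derivative_iff_quotient_tendsto by simp
      have "\<forall>\<^sub>F h in at_right 0. h \<in> {0<..<1::real}"
        by (rule eventually_at_right_real) simp
      then have "\<forall>\<^sub>F h in at_right 0. t + h \<in> {0..t+1} \<and> t + h \<noteq> t"
        by eventually_elim (use t in auto)
      then show "filterlim (\<lambda>h. t + h) (at t within {0..t+1}) (at_right 0)"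
        unfolding filterlim_at by (auto intro!: tendsto_eq_intros)
    qed
    then show ?thesis by simp
  qed
  have TI: "T \<delta> (I h) = I (\<delta> + h) - I \<delta>" if d: "0 \<le> \<delta>" and h: "0 \<le> h" for \<delta> h
  proof -
    have "T \<delta> (I h) = integral {0..h} (\<lambda>s. T \<delta> (T s x))"
      unfolding I_def
      by (rule bounded_linear_on_subspace_integral[OF subspace_V closed_V lin[OF d] bdd[OF d] h])
         (auto intro: continuous_on_subset[OF orbit_continuous_on[OF x]] maps x)
    also have "\<dots> = integral {0..h} (\<lambda>s. T (s + \<delta>) x)"
      by (rule integral_cong) (use add[OF d _ x] in \<open>simp add: add.commute\<close>)
    also have "\<dots> = integral {\<delta>..\<delta> + h} (\<lambda>s. T s x)"
      using integral_shift_real_ivl[of \<delta> \<delta> "\<delta> + h" "\<lambda>s. T s x"] by simp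
    also have "\<dots> = I (\<delta> + h) - I \<delta>"
      unfolding I_def using Henstock_Kurzweil_Integration.integral_combine[of 0 \<delta> "\<delta> + h" "\<lambda>s. T s x"] d h ion by (simp add: algebra_simps)
    finally show ?thesis .
  qed
  have gen: "generator_maps ((1 / h) *\<^sub>R I h) ((1 / h) *\<^sub>R (T h x - x))" if h: "0 < h" for h
  proof -
    have I0: "I 0 = 0" by (simp add: I_def)
    have "((\<lambda>\<delta>. (1 / h) *\<^sub>R ((1 / \<delta>) *\<^sub>R (I (h + \<delta>) - I h) - (1 / \<delta>) *\<^sub>R (I (0 + \<delta>) - I 0)))
        \<longlongrightarrow> (1 / h) *\<^sub>R (T h x - T 0 x)) (at_right 0)"
      by (intro tendsto_scaleR tendsto_const tendsto_diff lim) (use h in auto)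
    moreover have "(1 / h) *\<^sub>R ((1 / \<delta>) *\<^sub>R (I (h + \<delta>) - I h) - (1 / \<delta>) *\<^sub>R (I (0 + \<delta>) - I 0))
         = (1 / \<delta>) *\<^sub>R (T \<delta> ((1 / h) *\<^sub>R I h) - (1 / h) *\<^sub>R I h)" if "\<delta> > 0" for \<delta>
    proof -
      have "T \<delta> ((1 / h) *\<^sub>R I h) = (1 / h) *\<^sub>R (I (\<delta> + h) - I \<delta>)"
        using scale[of \<delta> "I h" "1 / h"] TI[of \<delta> h] IV[of h] h that by simp
      then show ?thesis by (simp add: I0 scaleR_diff_right add.commute mult.commute)
    qed
    then have "\<forall>\<^sub>F \<delta> in at_right 0.
       (1 / h) *\<^sub>R ((1 / \<delta>) *\<^sub>R (I (h + \<delta>) - I h) - (1 / \<delta>) *\<^sub>R (I (0 + \<delta>) - I 0))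
         = (1 / \<delta>) *\<^sub>R (T \<delta> ((1 / h) *\<^sub>R I h) - (1 / h) *\<^sub>R I h)"
      by (simp add: eventually_at_filter)
    ultimately have "((\<lambda>\<delta>. (1 / \<delta>) *\<^sub>R (T \<delta> ((1 / h) *\<^sub>R I h) - (1 / h) *\<^sub>R I h))
        \<longlongrightarrow> (1 / h) *\<^sub>R (T h x - T 0 x)) (at_right 0)"
      using tendsto_cong by fast
    then show ?thesis
      unfolding generator_maps_def using h IV x maps at_0 subspace_V
      by (simp add: subspace_scale subspace_diff)
  qed
  have "((\<lambda>h. (1 / h) *\<^sub>R I h) \<longlongrightarrow> x) (at_right 0)"
    using lim[of 0] at_0[OF x] by (simp add: I_def)
  then have "\<forall>\<^sub>F h in at_right 0. dist ((1 / h) *\<^sub>R I h) x < \<epsilon>" using \<epsilon> by (rule tendstoD)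
  moreover have "\<forall>\<^sub>F h in at_right 0. h > (0::real)" by (simp add: eventually_at_filter)
  ultimately have "\<forall>\<^sub>F h in at_right 0. h > (0::real) \<and> dist ((1 / h) *\<^sub>R I h) x < \<epsilon>"
    by eventually_elim auto
  then obtain h where "h > 0" "dist ((1 / h) *\<^sub>R I h) x < \<epsilon>"
    using eventually_happens'[OF trivial_limit_at_right_real] by blast
  then show thesis using that[OF gen] by (auto simp: dist_norm)
qed

lemma orbit_const_if_gen_0:
  assumes "generator_maps x 0" "t \<ge> 0"
  shows "T t x = x"
proof -
  have "((\<lambda>s. T s x) has_vector_derivative 0) (at s within {0..})" if "s \<in> {0..}" for s
    using orbit_has_derivative[OF assms(1), of s] that zero[of s] by simp
  then obtain c where c: "\<And>s. s \<in> {0..} \<Longrightarrow> T s x = c"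
    using has_vector_derivative_zero_constant[OF convex_real_interval(1)] by blast
  show ?thesis using c[of t] c[of 0] at_0[of x] assms unfolding generator_maps_def by simp
qed

end

section \<open>\<open>L\<^sup>2(M)\<close> as a closed subspace of a Banach space\<close>

lemma Lsq_real_iff: "f \<in> Lsq M \<longleftrightarrow> f \<in> borel_measurable M \<and> integrable M (\<lambda>x. (f x)\<^sup>2)"
  for f :: "'a \<Rightarrow> real"
  unfolding Lsq_def by simp

lemma Lsq_norm_nonneg [simp]: "0 \<le> Lsq_norm M f"
  unfolding Lsq_norm_def by simp

lemma Lsq_norm_sq: "(Lsq_norm M f)\<^sup>2 = (\<integral>x. (f x)\<^sup>2 \<partial>M)" for f :: "'a \<Rightarrow> real"
  unfolding Lsq_norm_def by simp

lemma Lsq_mult_integrable: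
  fixes f g :: "'a \<Rightarrow> real"
  assumes "f \<in> Lsq M" "g \<in> Lsq M"
  shows "integrable M (\<lambda>x. f x * g x)"
proof (rule Bochner_Integration.integrable_bound)
  show "integrable M (\<lambda>x. (f x)\<^sup>2 + (g x)\<^sup>2)"
    using assms unfolding Lsq_real_iff by auto
  show "(\<lambda>x. f x * g x) \<in> borel_measurable M"
    using assms unfolding Lsq_real_iff by auto
  have "\<bar>a * b\<bar> \<le> a\<^sup>2 + b\<^sup>2" for a b :: real
    using sum_squares_bound[of "\<bar>a\<bar>" "\<bar>b\<bar>"] mult_nonneg_nonneg[of "\<bar>a\<bar>" "\<bar>b\<bar>"]
    unfolding abs_mult power2_abs by linarith
  then show "AE x in M. norm (f x * g x) \<le> norm ((f x)\<^sup>2 + (g x)\<^sup>2)" by simp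
qed

lemma Lsq_lincomb:
  fixes f g :: "'a \<Rightarrow> real"
  assumes "f \<in> Lsq M" "g \<in> Lsq M"
  shows "(\<lambda>x. a * f x + b * g x) \<in> Lsq M"
proof -
  have "integrable M (\<lambda>x. a\<^sup>2 * (f x)\<^sup>2 + 2 * a * b * (f x * g x) + b\<^sup>2 * (g x)\<^sup>2)"
    using assms Lsq_mult_integrable[OF assms] unfolding Lsq_real_iff by auto
  moreover have "(a * f x + b * g x)\<^sup>2 = a\<^sup>2 * (f x)\<^sup>2 + 2 * a * b * (f x * g x) + b\<^sup>2 * (g x)\<^sup>2" for x
    by (simp add: power2_eq_square algebra_simps)
  ultimately show ?thesis using assms unfolding Lsq_real_iff by auto
qed

lemma Lsq_diff: "f \<in> Lsq M \<Longrightarrow> g \<in> Lsq M \<Longrightarrow> (\<lambda>x. f x - g x) \<in> Lsq M"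
  for f g :: "'a \<Rightarrow> real"
  using Lsq_lincomb[of f M g 1 "-1"] by simp

lemma Lsq_scale: "f \<in> Lsq M \<Longrightarrow> (\<lambda>x. a * f x) \<in> Lsq M" for f :: "'a \<Rightarrow> real"
  using Lsq_lincomb[of f M f a 0] by simp

lemma Lsq_zero [simp]: "(\<lambda>x. 0) \<in> Lsq M" for M :: "'a measure"
  by (simp add: Lsq_def)

lemma Lsq_norm_eq_0_iff:
  fixes f :: "'a \<Rightarrow> real"
  assumes "f \<in> Lsq M"
  shows "Lsq_norm M f = 0 \<longleftrightarrow> (AE x in M. f x = 0)"
proof -
  have "(\<integral>x. (f x)\<^sup>2 \<partial>M) = 0 \<longleftrightarrow> (AE x in M. (f x)\<^sup>2 = 0)"
    by (rule integral_nonneg_eq_0_iff_AE) (use assms in \<open>simp_all add: Lsq_real_iff\<close>)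
  then show ?thesis unfolding Lsq_norm_def by simp
qed

text \<open>
  The usual discriminant argument, applied to the nonnegative quadratic form
  \<open>(a, b) \<mapsto> \<integral> (a f + b g)\<^sup>2\<close>.
\<close>

lemma Lsq_Cauchy_Schwarz:
  fixes f g :: "'a \<Rightarrow> real"
  assumes f: "f \<in> Lsq M" and g: "g \<in> Lsq M"
  shows "\<bar>\<integral>x. f x * g x \<partial>M\<bar> \<le> Lsq_norm M f * Lsq_norm M g"
proof -
  define A B C where "A = (\<integral>x. (f x)\<^sup>2 \<partial>M)" and "B = (\<integral>x. f x * g x \<partial>M)"
    and "C = (\<integral>x. (g x)\<^sup>2 \<partial>M)"
  have int: "integrable M (\<lambda>x. (f x)\<^sup>2)" "integrable M (\<lambda>x. f x * g x)" "integrable M (\<lambda>x. (g x)\<^sup>2)"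
    using f g Lsq_mult_integrable[OF f g] by (simp_all add: Lsq_real_iff)
  have quad: "0 \<le> a\<^sup>2 * A + 2 * a * b * B + b\<^sup>2 * C" for a b
  proof -
    have "(\<integral>x. (a * f x + b * g x)\<^sup>2 \<partial>M) = (\<integral>x. a\<^sup>2 * (f x)\<^sup>2 + 2 * a * b * (f x * g x) + b\<^sup>2 * (g x)\<^sup>2 \<partial>M)"
      by (intro Bochner_Integration.integral_cong refl) (simp add: power2_eq_square algebra_simps)
    also have "\<dots> = a\<^sup>2 * A + 2 * a * b * B + b\<^sup>2 * C"
      unfolding A_def B_def C_def using int by simp
    finally show ?thesis
      using Bochner_Integration.integral_nonneg[of M "\<lambda>x. (a * f x + b * g x)\<^sup>2"] by simp
  qed
  have A0: "A \<ge> 0" and C0: "C \<ge> 0" unfolding A_def C_def by auto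
  have "B\<^sup>2 \<le> A * C"
  proof (cases "A = 0")
    case True
    then show ?thesis
    proof (cases "B = 0")
      case False
      have "0 \<le> (- (2 * C) - 2) / 2 + C"
        using quad[of "- (C + 1) / (2 * B)" 1] True False by simp
      then show ?thesis by (simp add: field_simps)
    qed simp
  next
    case False
    have "0 \<le> A * (A * C - B\<^sup>2)"
      using quad[of "-B" A] by (simp add: power2_eq_square algebra_simps)
    then show ?thesis using False A0 by (simp add: zero_le_mult_iff)
  qed
  then have "\<bar>B\<bar> \<le> sqrt (A * C)" using real_le_rsqrt[of "\<bar>B\<bar>"] by simp
  then show ?thesis unfolding Lsq_norm_def A_def B_def C_def by (simp add: real_sqrt_mult)
qed

text \<open>
  A function \<open>f\<close> is represented by the functional \<open>g \<mapsto> \<integral> f g\<close> on the unit ball of \<open>L\<^sup>2(M)\<close>, extended by \<open>0\<close> to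
  all functions. With the discrete topology on the index set these are bounded continuous functions, so
  they live in a Banach space that does not depend on \<open>M\<close>, and their supremum norm is the norm
  of \<open>L\<^sup>2(M)\<close>. Functions equal almost everywhere get the same image.
\<close>

definition L2_embed :: "'a measure \<Rightarrow> ('a \<Rightarrow> real) \<Rightarrow> (('a \<Rightarrow> real) discrete \<Rightarrow>\<^sub>C real)" where
  "L2_embed M f = Bcontfun (\<lambda>g. if of_discrete g \<in> Lsq M \<and> Lsq_norm M (of_discrete g) \<le> 1
     then \<integral>x. f x * of_discrete g x \<partial>M else 0)"

lemma continuous_on_discrete: "continuous_on S (f :: 'a discrete \<Rightarrow> 'b::topological_space)"
  unfolding continuous_on_topological
proof (intro ballI allI impI)
  fix x B assume "f x \<in> B"
  then show "\<exists>A. open A \<and> x \<in> A \<and> (\<forall>y\<in>S. y \<in> A \<longrightarrow> f y \<in> B)"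
    by (intro exI[of _ "{x}"]) (simp add: open_discrete)
qed

lemma apply_L2_embed:
  assumes f: "f \<in> Lsq M"
  shows "apply_bcontfun (L2_embed M f) g = (if of_discrete g \<in> Lsq M \<and> Lsq_norm M (of_discrete g) \<le> 1
     then \<integral>x. f x * of_discrete g x \<partial>M else 0)"
proof -
  let ?F = "\<lambda>g. if of_discrete g \<in> Lsq M \<and> Lsq_norm M (of_discrete g) \<le> 1
     then \<integral>x. f x * of_discrete g x \<partial>M else 0"
  have "norm (?F g) \<le> Lsq_norm M f" for g
    using Lsq_Cauchy_Schwarz[OF f, of "of_discrete g"]
      mult_left_mono[of "Lsq_norm M (of_discrete g)" 1 "Lsq_norm M f"] by auto
  then have "?F \<in> bcontfun"
    by (rule bcontfun_normI[OF continuous_on_discrete])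
  then show ?thesis unfolding L2_embed_def by (simp add: Bcontfun_inverse)
qed

lemma L2_embed_lincomb:
  assumes f: "f \<in> Lsq M" and g: "g \<in> Lsq M"
  shows "L2_embed M (\<lambda>x. a * f x + b * g x) = a *\<^sub>R L2_embed M f + b *\<^sub>R L2_embed M g"
proof (rule bcontfun_eqI)
  fix h
  have "(\<integral>x. (a * f x + b * g x) * of_discrete h x \<partial>M)
      = a * (\<integral>x. f x * of_discrete h x \<partial>M) + b * (\<integral>x. g x * of_discrete h x \<partial>M)"
    if h: "of_discrete h \<in> Lsq M"
  proof -
    have "(\<integral>x. (a * f x + b * g x) * of_discrete h x \<partial>M)
        = (\<integral>x. a * (f x * of_discrete h x) + b * (g x * of_discrete h x) \<partial>M)"
      by (simp add: algebra_simps)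
    then show ?thesis using Lsq_mult_integrable[OF f h] Lsq_mult_integrable[OF g h] by simp
  qed
  then show "apply_bcontfun (L2_embed M (\<lambda>x. a * f x + b * g x)) h
      = apply_bcontfun (a *\<^sub>R L2_embed M f + b *\<^sub>R L2_embed M g) h"
    by (simp add: apply_L2_embed f g Lsq_lincomb)
qed

lemma L2_embed_diff:
  "f \<in> Lsq M \<Longrightarrow> g \<in> Lsq M \<Longrightarrow> L2_embed M (\<lambda>x. f x - g x) = L2_embed M f - L2_embed M g"
  using L2_embed_lincomb[of f M g 1 "-1"] by simp

lemma L2_embed_scale: "f \<in> Lsq M \<Longrightarrow> L2_embed M (\<lambda>x. a * f x) = a *\<^sub>R L2_embed M f"
  using L2_embed_lincomb[of f M f a 0] by simp

lemma norm_L2_embed: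
  assumes f: "f \<in> Lsq M"
  shows "norm (L2_embed M f) = Lsq_norm M f"
proof (rule antisym)
  show "norm (L2_embed M f) \<le> Lsq_norm M f"
  proof (rule norm_bound)
    show "norm (apply_bcontfun (L2_embed M f) g) \<le> Lsq_norm M f" for g
      using Lsq_Cauchy_Schwarz[OF f, of "of_discrete g"]
        mult_left_mono[of "Lsq_norm M (of_discrete g)" 1 "Lsq_norm M f"]
      by (auto simp: apply_L2_embed[OF f])
  qed
  show "Lsq_norm M f \<le> norm (L2_embed M f)"
  proof (cases "Lsq_norm M f = 0")
    case False
    define c where "c = Lsq_norm M f"
    have c: "c > 0" using False Lsq_norm_nonneg[of M f] unfolding c_def by linarith
    have sq: "(\<integral>x. (f x)\<^sup>2 \<partial>M) = c\<^sup>2" unfolding c_def Lsq_norm_sq by simp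
    \<comment> \<open>The supremum over the unit ball is attained at the normalised \<open>f\<close>.\<close>
    define g where "g = (\<lambda>x. (1 / c) * f x)"
    have g: "g \<in> Lsq M" unfolding g_def by (rule Lsq_scale[OF f])
    have "(Lsq_norm M g)\<^sup>2 = 1"
      unfolding Lsq_norm_sq g_def power_mult_distrib using c by (simp add: sq power_divide)
    then have g1: "Lsq_norm M g = 1" using Lsq_norm_nonneg[of M g] by (simp add: power2_eq_1_iff)
    have "apply_bcontfun (L2_embed M f) (discrete g) = (\<integral>x. (1 / c) * (f x)\<^sup>2 \<partial>M)"
      using g g1 by (simp add: apply_L2_embed[OF f] discrete_inverse)
        (simp add: g_def power2_eq_square)
    also have "\<dots> = c" using c by (simp add: sq) (simp add: power2_eq_square)
    finally show ?thesis using norm_bounded[of "L2_embed M f" "discrete g"] c c_def by simp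
  qed simp
qed

lemma L2_embed_eq_iff:
  assumes f: "f \<in> Lsq M" and g: "g \<in> Lsq M"
  shows "L2_embed M f = L2_embed M g \<longleftrightarrow> (AE x in M. f x = g x)"
proof -
  have "L2_embed M f = L2_embed M g \<longleftrightarrow> norm (L2_embed M (\<lambda>x. f x - g x)) = 0"
    by (simp add: L2_embed_diff f g)
  also have "\<dots> \<longleftrightarrow> (AE x in M. f x - g x = 0)"
    using norm_L2_embed[OF Lsq_diff[OF f g]] Lsq_norm_eq_0_iff[OF Lsq_diff[OF f g]] by simp
  finally show ?thesis by simp
qed

lemma Lsq_tendsto_iff_L2_embed:
  "Lsq_tendsto M fs f F \<longleftrightarrow> f \<in> Lsq M \<and> (\<forall>\<^sub>F i in F. fs i \<in> Lsq M) \<and>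
     ((\<lambda>i. L2_embed M (fs i)) \<longlongrightarrow> L2_embed M f) F" for f :: "'a \<Rightarrow> real"
proof -
  have "((\<lambda>i. Lsq_norm M (\<lambda>x. fs i x - f x)) \<longlongrightarrow> 0) F \<longleftrightarrow>
     ((\<lambda>i. L2_embed M (fs i)) \<longlongrightarrow> L2_embed M f) F"
    if f: "f \<in> Lsq M" and ev: "\<forall>\<^sub>F i in F. fs i \<in> Lsq M"
  proof -
    have "\<forall>\<^sub>F i in F. Lsq_norm M (\<lambda>x. fs i x - f x) = dist (L2_embed M (fs i)) (L2_embed M f)"
      using ev
    proof eventually_elim
      case (elim i)
      then show ?case
        using norm_L2_embed[OF Lsq_diff[OF elim f]] by (simp add: L2_embed_diff f dist_norm)
    qed
    then have "((\<lambda>i. Lsq_norm M (\<lambda>x. fs i x - f x)) \<longlongrightarrow> 0) F \<longleftrightarrow>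
       ((\<lambda>i. dist (L2_embed M (fs i)) (L2_embed M f)) \<longlongrightarrow> 0) F"
      by (rule filterlim_cong[OF refl refl])
    then show ?thesis by (simp add: tendsto_dist_iff[symmetric])
  qed
  then show ?thesis unfolding Lsq_tendsto_def by blast
qed

lemma subspace_L2: "subspace (L2_embed M ` Lsq M)"
  unfolding subspace_def
proof (intro conjI ballI allI)
  show "0 \<in> L2_embed M ` Lsq M"
    using L2_embed_scale[of "\<lambda>x. 0" M 0] by (intro image_eqI[of _ _ "\<lambda>x. 0"]) auto
  show "u + v \<in> L2_embed M ` Lsq M" if "u \<in> L2_embed M ` Lsq M" "v \<in> L2_embed M ` Lsq M" for u v
  proof -
    obtain f g where "f \<in> Lsq M" "g \<in> Lsq M" "u = L2_embed M f" "v = L2_embed M g"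
      using \<open>u \<in> _\<close> \<open>v \<in> _\<close> by blast
    then show ?thesis
      using L2_embed_lincomb[of f M g 1 1] Lsq_lincomb[of f M g 1 1]
      by (intro image_eqI[of _ _ "\<lambda>x. 1 * f x + 1 * g x"]) simp_all
  qed
  show "c *\<^sub>R u \<in> L2_embed M ` Lsq M" if "u \<in> L2_embed M ` Lsq M" for c u
  proof -
    obtain f where "f \<in> Lsq M" "u = L2_embed M f"
      using \<open>u \<in> _\<close> by blast
    then show ?thesis
      by (intro image_eqI[of _ _ "\<lambda>x. c * f x"]) (simp_all add: L2_embed_scale Lsq_scale)
  qed
qed

context finite_measure
begin

lemma Lsq_bounded:
  fixes f :: "'a \<Rightarrow> real"
  assumes "f \<in> borel_measurable M" "\<And>x. \<bar>f x\<bar> \<le> B"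
  shows "f \<in> Lsq M"
proof -
  have "(f x)\<^sup>2 \<le> B\<^sup>2" for x
    using power_mono[OF assms(2)[of x], of 2] by simp
  then have "integrable M (\<lambda>x. (f x)\<^sup>2)"
    using assms(1) by (intro integrable_const_bound[where B = "B\<^sup>2"]) auto
  then show ?thesis using assms(1) unfolding Lsq_real_iff by blast
qed

lemma Lsq_const [simp]: "(\<lambda>x. c :: real) \<in> Lsq M"
  by (simp add: Lsq_def)

lemma Lsq_integrable: "f \<in> Lsq M \<Longrightarrow> integrable M f" for f :: "'a \<Rightarrow> real"
  using Lsq_mult_integrable[of f M "\<lambda>x. 1"] by simp

lemma Lsq_integral_abs_le:
  fixes f :: "'a \<Rightarrow> real"
  assumes f: "f \<in> Lsq M"
  shows "(\<integral>x. \<bar>f x\<bar> \<partial>M) \<le> Lsq_norm M f * Lsq_norm M (\<lambda>x. 1 :: real)"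
proof -
  have "(\<lambda>x. \<bar>f x\<bar>) \<in> Lsq M" using f unfolding Lsq_real_iff by auto
  moreover have "Lsq_norm M (\<lambda>x. \<bar>f x\<bar>) = Lsq_norm M f" unfolding Lsq_norm_def by simp
  ultimately show ?thesis using Lsq_Cauchy_Schwarz[of "\<lambda>x. \<bar>f x\<bar>" M "\<lambda>x. 1"] by simp
qed

text \<open>
  On a finite measure space the \<open>L\<^sup>1\<close>-norm is dominated by the \<open>L\<^sup>2\<close>-norm, so the increments of \<open>h\<close> have
  summable integrals and their sum is finite almost everywhere.
\<close>

lemma fast_Cauchy_Lsq_AE_convergent:
  fixes h :: "nat \<Rightarrow> 'a \<Rightarrow> real"
  assumes h: "\<And>n. h n \<in> Lsq M"
    and fast: "\<And>n. Lsq_norm M (\<lambda>x. h (Suc n) x - h n x) \<le> c * (1/2) ^ n"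
  shows "AE x in M. convergent (\<lambda>n. h n x)"
proof -
  define d where "d n x = \<bar>h (Suc n) x - h n x\<bar>" for n x
  define B where "B = Lsq_norm M (\<lambda>x. 1 :: real)"
  have dL: "(\<lambda>x. h (Suc n) x - h n x) \<in> Lsq M" for n by (intro Lsq_diff h)
  have [measurable]: "h n \<in> borel_measurable M" for n using h unfolding Lsq_def by auto
  have le: "(\<integral>\<^sup>+x. ennreal (d n x) \<partial>M) \<le> ennreal (c * B * (1/2) ^ n)" for n
  proof -
    have "(\<integral>\<^sup>+x. ennreal (d n x) \<partial>M) = ennreal (\<integral>x. d n x \<partial>M)"
      unfolding d_def by (intro nn_integral_eq_integral integrable_abs Lsq_integrable dL) auto
    also have "(\<integral>x. d n x \<partial>M) \<le> c * (1/2) ^ n * B"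
      unfolding d_def B_def
      by (rule order_trans[OF Lsq_integral_abs_le[OF dL] mult_right_mono[OF fast]]) simp
    finally show ?thesis by (simp add: mult_ac ennreal_leI)
  qed
  have "(\<integral>\<^sup>+x. (\<Sum>n. ennreal (d n x)) \<partial>M) = (\<Sum>n. \<integral>\<^sup>+x. ennreal (d n x) \<partial>M)"
    unfolding d_def by (rule nn_integral_suminf) measurable
  also have "\<dots> \<le> (\<Sum>n. ennreal (c * B * (1/2) ^ n))"
    by (intro suminf_le le) auto
  also have "\<dots> < \<infinity>"
  proof -
    have cB: "0 \<le> c * B"
      using order_trans[OF Lsq_norm_nonneg fast[of 0]] unfolding B_def
      by (intro mult_nonneg_nonneg) auto
    have "summable (\<lambda>n. c * B * (1/2::real) ^ n)" by (intro summable_mult summable_geometric) simp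
    then show ?thesis using cB by (simp add: suminf_ennreal2 del: ennreal_mult')
  qed
  finally have "AE x in M. (\<Sum>n. ennreal (d n x)) \<noteq> \<infinity>"
    by (intro nn_integral_PInf_AE) (auto simp: d_def)
  then show ?thesis
  proof eventually_elim
    case (elim x)
    have "summable (\<lambda>n. d n x)"
      by (rule summable_suminf_not_top) (use elim in \<open>auto simp: d_def\<close>)
    then have "summable (\<lambda>n. h (Suc n) x - h n x)" unfolding d_def by (rule summable_rabs_cancel)
    then have "convergent (\<lambda>n. \<Sum>i<n. h (Suc i) x - h i x)" by (simp add: summable_iff_convergent)
    then have "convergent (\<lambda>n. h n x - h 0 x)" 
      by (simp only: sum_lessThan_telescope[of "\<lambda>n. h n x"])
    then show ?case by (simp add: convergent_diff_const_right_iff)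
  qed
qed

text \<open>
  The Riesz-Fischer theorem: from a convergent sequence in the image one extracts functions \<open>h n\<close> that
  converge fast, takes their almost everywhere limit \<open>f\<close>, and bounds \<open>\<integral> (f - h n)\<^sup>2\<close> by Fatou's lemma.
\<close>

lemma closed_L2: "closed (L2_embed M ` Lsq M)"
  unfolding closed_sequential_limits
proof (intro allI impI, elim conjE)
  fix y l assume mem: "\<forall>n. y n \<in> L2_embed M ` Lsq M" and lim: "y \<longlonglongrightarrow> l"
  have "\<exists>f\<in>Lsq M. dist (L2_embed M f) l < (1/2) ^ n" for n
  proof -
    obtain m where "dist (y m) l < (1/2) ^ n"
      using metric_LIMSEQ_D[OF lim, of "(1/2) ^ n"] by auto
    then show ?thesis using mem by (metis imageE)
  qed
  then obtain h where h: "\<And>n. h n \<in> Lsq M" and hl: "\<And>n. dist (L2_embed M (h n)) l < (1/2) ^ n"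
    by metis
  have [measurable]: "h n \<in> borel_measurable M" for n using h unfolding Lsq_def by auto
  have hh: "Lsq_norm M (\<lambda>x. h m x - h n x) \<le> 2 * (1/2) ^ n" if "n \<le> m" for n m
  proof -
    have "Lsq_norm M (\<lambda>x. h m x - h n x) = dist (L2_embed M (h m)) (L2_embed M (h n))"
      using norm_L2_embed[OF Lsq_diff[OF h h]] by (simp add: L2_embed_diff h dist_norm)
    also have "\<dots> \<le> dist (L2_embed M (h m)) l + dist (L2_embed M (h n)) l" by (rule dist_triangle2)
    also have "\<dots> \<le> (1/2) ^ m + (1/2) ^ n" using hl[of m] hl[of n] by linarith
    also have "(1/2::real) ^ m \<le> (1/2) ^ n" using that by (simp add: power_decreasing)
    finally show ?thesis by simp
  qed
  define f where "f x = lim (\<lambda>n. h n x)" for x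
  have [measurable]: "f \<in> borel_measurable M" unfolding f_def by measurable
  have "AE x in M. convergent (\<lambda>n. h n x)"
    by (rule fast_Cauchy_Lsq_AE_convergent[OF h hh]) simp
  then have conv: "AE x in M. (\<lambda>n. h n x) \<longlonglongrightarrow> f x"
    by eventually_elim (simp add: f_def convergent_LIMSEQ_iff)
  have est: "(\<integral>\<^sup>+x. ennreal ((f x - h n x)\<^sup>2) \<partial>M) \<le> ennreal ((2 * (1/2) ^ n)\<^sup>2)" for n
  proof -
    have "(\<integral>\<^sup>+x. ennreal ((f x - h n x)\<^sup>2) \<partial>M)
        = (\<integral>\<^sup>+x. liminf (\<lambda>m. ennreal ((h m x - h n x)\<^sup>2)) \<partial>M)"
    proof (rule nn_integral_cong_AE, use conv in eventually_elim)
      case (elim x)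
      have "(\<lambda>m. ennreal ((h m x - h n x)\<^sup>2)) \<longlonglongrightarrow> ennreal ((f x - h n x)\<^sup>2)"
        by (intro tendsto_intros elim)
      then show ?case by (rule lim_imp_Liminf[OF trivial_limit_sequentially, symmetric])
    qed
    also have "\<dots> \<le> liminf (\<lambda>m. \<integral>\<^sup>+x. ennreal ((h m x - h n x)\<^sup>2) \<partial>M)"
      by (rule nn_integral_liminf) measurable
    also have "\<dots> \<le> liminf (\<lambda>m. ennreal ((2 * (1/2) ^ n)\<^sup>2))"
    proof (rule Liminf_mono)
      show "\<forall>\<^sub>F m in sequentially. (\<integral>\<^sup>+x. ennreal ((h m x - h n x)\<^sup>2) \<partial>M) \<le> ennreal ((2 * (1/2) ^ n)\<^sup>2)"
        unfolding eventually_sequentially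
      proof (intro exI allI impI)
        fix m assume m: "n \<le> m"
        have "(\<integral>\<^sup>+x. ennreal ((h m x - h n x)\<^sup>2) \<partial>M) = ennreal ((Lsq_norm M (\<lambda>x. h m x - h n x))\<^sup>2)"
          unfolding Lsq_norm_sq
          by (rule nn_integral_eq_integral) (use Lsq_diff[OF h h] in \<open>auto simp: Lsq_real_iff\<close>)
        also have "\<dots> \<le> ennreal ((2 * (1/2) ^ n)\<^sup>2)"
          by (intro ennreal_leI power_mono hh m) simp
        finally show "(\<integral>\<^sup>+x. ennreal ((h m x - h n x)\<^sup>2) \<partial>M) \<le> ennreal ((2 * (1/2) ^ n)\<^sup>2)" .
      qed
    qed
    also have "\<dots> = ennreal ((2 * (1/2) ^ n)\<^sup>2)" by (simp add: Liminf_const)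
    finally show ?thesis .
  qed
  have fh: "(\<lambda>x. f x - h n x) \<in> Lsq M" for n
    unfolding Lsq_real_iff
  proof
    have "(\<integral>\<^sup>+x. ennreal ((f x - h n x)\<^sup>2) \<partial>M) < \<infinity>"
      using est[of n] by (rule le_less_trans) simp
    then show "integrable M (\<lambda>x. (f x - h n x)\<^sup>2)"
      by (intro integrableI_nonneg) auto
  qed simp
  have f: "f \<in> Lsq M" using Lsq_lincomb[OF fh[of 0] h[of 0], of 1 1] by simp
  have dle: "dist (L2_embed M (h n)) (L2_embed M f) \<le> 2 * (1/2) ^ n" for n
  proof -
    have "ennreal ((Lsq_norm M (\<lambda>x. f x - h n x))\<^sup>2) \<le> ennreal ((2 * (1/2) ^ n)\<^sup>2)"
      using est[of n] nn_integral_eq_integral[of M "\<lambda>x. (f x - h n x)\<^sup>2"] fh[of n]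
      unfolding Lsq_norm_sq Lsq_real_iff by simp
    then have "(Lsq_norm M (\<lambda>x. f x - h n x))\<^sup>2 \<le> (2 * (1/2) ^ n)\<^sup>2"
      by (simp only: ennreal_le_iff zero_le_power2)
    then have "Lsq_norm M (\<lambda>x. f x - h n x) \<le> 2 * (1/2) ^ n"
      by (rule power2_le_imp_le) simp
    then show ?thesis
      using norm_L2_embed[OF fh[of n]] by (simp add: L2_embed_diff f h dist_norm norm_minus_commute)
  qed
  have lim2: "(\<lambda>n. 2 * (1/2::real) ^ n) \<longlonglongrightarrow> 0"
    by (intro tendsto_mult_right_zero LIMSEQ_power_zero) simp
  have "(\<lambda>n. dist (L2_embed M (h n)) (L2_embed M f)) \<longlonglongrightarrow> 0"
    by (rule tendsto_sandwich[OF _ _ tendsto_const lim2]) (simp_all add: dle)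
  then have "(\<lambda>n. L2_embed M (h n)) \<longlonglongrightarrow> L2_embed M f" by (simp add: tendsto_dist_iff[symmetric])
  moreover have "(\<lambda>n. L2_embed M (h n)) \<longlonglongrightarrow> l"
  proof -
    have "(\<lambda>n. dist (L2_embed M (h n)) l) \<longlonglongrightarrow> 0"
      by (rule tendsto_sandwich[OF _ _ tendsto_const LIMSEQ_power_zero[of "1/2::real"]])
         (auto intro!: always_eventually less_imp_le hl)
    then show ?thesis by (simp add: tendsto_dist_iff[symmetric])
  qed
  ultimately have "l = L2_embed M f" using LIMSEQ_unique by blast
  then show "l \<in> L2_embed M ` Lsq M" using f by blast
qed

end

section \<open>Strongly continuous semigroups on \<open>L\<^sup>2(M)\<close>\<close>

text \<open>
  The semigroup transported to the image of \<open>L2_embed\<close>. The choice of a representative by \<open>inv_into\<close> is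
  harmless: a bounded linear \<open>P t\<close> maps functions that are equal almost everywhere to such functions.
\<close>

definition L2_semigroup :: "'a measure \<Rightarrow> (real \<Rightarrow> ('a \<Rightarrow> real) \<Rightarrow> 'a \<Rightarrow> real) \<Rightarrow> real \<Rightarrow>
    (('a \<Rightarrow> real) discrete \<Rightarrow>\<^sub>C real) \<Rightarrow> (('a \<Rightarrow> real) discrete \<Rightarrow>\<^sub>C real)" where
  "L2_semigroup M P t y = L2_embed M (P t (inv_into (Lsq M) (L2_embed M) y))"

lemma
  assumes sg: "C0_semigroup M P" and t: "t \<ge> 0"
  shows C0_semigroup_Lsq: "f \<in> Lsq M \<Longrightarrow> P t f \<in> Lsq M"
    and L2_embed_semigroup_lincomb: "f \<in> Lsq M \<Longrightarrow> g \<in> Lsq M \<Longrightarrow>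
      L2_embed M (P t (\<lambda>x. a * f x + b * g x)) = a *\<^sub>R L2_embed M (P t f) + b *\<^sub>R L2_embed M (P t g)"
    and L2_embed_semigroup_bounded:
      "\<exists>K. \<forall>f\<in>Lsq M. norm (L2_embed M (P t f)) \<le> K * norm (L2_embed M f)"
proof -
  show P: "P t f \<in> Lsq M" if "f \<in> Lsq M" for f
    using sg t that unfolding C0_semigroup_def by blast
  show "L2_embed M (P t (\<lambda>x. a * f x + b * g x)) = a *\<^sub>R L2_embed M (P t f) + b *\<^sub>R L2_embed M (P t g)"
    if f: "f \<in> Lsq M" and g: "g \<in> Lsq M"
  proof -
    have "AE x in M. P t (\<lambda>y. a * f y + b * g y) x = a * P t f x + b * P t g x"
      using sg t f g unfolding C0_semigroup_def by blast
    then have "L2_embed M (P t (\<lambda>x. a * f x + b * g x)) = L2_embed M (\<lambda>x. a * P t f x + b * P t g x)"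
      by (subst L2_embed_eq_iff) (simp_all add: P Lsq_lincomb f g)
    then show ?thesis by (simp add: L2_embed_lincomb P f g)
  qed
  have "\<exists>K. \<forall>f\<in>Lsq M. Lsq_norm M (P t f) \<le> K * Lsq_norm M f"
    using sg t unfolding C0_semigroup_def by blast
  then show "\<exists>K. \<forall>f\<in>Lsq M. norm (L2_embed M (P t f)) \<le> K * norm (L2_embed M f)"
    using P by (simp add: norm_L2_embed)
qed

lemma L2_semigroup_embed:
  assumes sg: "C0_semigroup M P" and t: "t \<ge> 0" and f: "f \<in> Lsq M"
  shows "L2_semigroup M P t (L2_embed M f) = L2_embed M (P t f)"
proof -
  define g where "g = inv_into (Lsq M) (L2_embed M) (L2_embed M f)"
  have g: "g \<in> Lsq M" and gf: "L2_embed M g = L2_embed M f"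
    unfolding g_def using inv_into_into[OF imageI[OF f]] f_inv_into_f[OF imageI[OF f]] by auto
  obtain K where K: "\<forall>f\<in>Lsq M. norm (L2_embed M (P t f)) \<le> K * norm (L2_embed M f)"
    using L2_embed_semigroup_bounded[OF sg t] by blast
  have "norm (L2_embed M (P t (\<lambda>x. 1 * g x + (-1) * f x))) \<le> K * norm (L2_embed M (\<lambda>x. 1 * g x + (-1) * f x))"
    using K Lsq_lincomb[OF g f] by blast
  then have "L2_embed M (P t g) = L2_embed M (P t f)"
    unfolding L2_embed_semigroup_lincomb[OF sg t g f] L2_embed_lincomb[OF g f] by (simp add: gf)
  then show ?thesis unfolding L2_semigroup_def g_def .
qed

instance bcontfun :: (metric_space, banach) banach ..

context finite_measure
begin

lemma subspace_semigroup_L2: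
  assumes sg: "C0_semigroup M P"
  shows "subspace_semigroup (L2_embed M ` Lsq M) (L2_semigroup M P)"
proof
  let ?V = "L2_embed M ` Lsq M" and ?T = "L2_semigroup M P"
  show "subspace ?V" by (rule subspace_L2)
  show "closed ?V" by (rule closed_L2)
  show "?T t x \<in> ?V" if t: "t \<ge> 0" and x: "x \<in> ?V" for t x
    using x L2_semigroup_embed[OF sg t] C0_semigroup_Lsq[OF sg t] by force
  show "?T t (a *\<^sub>R x + b *\<^sub>R y) = a *\<^sub>R ?T t x + b *\<^sub>R ?T t y"
    if t: "t \<ge> 0" and x: "x \<in> ?V" and y: "y \<in> ?V" for t x y a b
  proof -
    obtain f g where f: "f \<in> Lsq M" "x = L2_embed M f" and g: "g \<in> Lsq M" "y = L2_embed M g"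
      using x y by blast
    show ?thesis
      using L2_semigroup_embed[OF sg t Lsq_lincomb[OF f(1) g(1)]] L2_semigroup_embed[OF sg t f(1)]
        L2_semigroup_embed[OF sg t g(1)] L2_embed_semigroup_lincomb[OF sg t f(1) g(1)]
      by (simp add: f g L2_embed_lincomb)
  qed
  show "\<exists>K. \<forall>x\<in>?V. norm (?T t x) \<le> K * norm x" if t: "t \<ge> 0" for t
    using L2_embed_semigroup_bounded[OF sg t] L2_semigroup_embed[OF sg t] by auto
  show "?T 0 x = x" if x: "x \<in> ?V" for x
  proof -
    obtain f where f: "f \<in> Lsq M" "x = L2_embed M f" using x by blast
    have "AE x in M. P 0 f x = f x" using sg f unfolding C0_semigroup_def by blast
    then have "L2_embed M (P 0 f) = L2_embed M f"
      using L2_embed_eq_iff[OF C0_semigroup_Lsq[OF sg order_refl f(1)] f(1)] by blast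
    then show ?thesis by (simp add: L2_semigroup_embed[OF sg] f)
  qed
  show "?T (s + t) x = ?T s (?T t x)" if s: "s \<ge> 0" and t: "t \<ge> 0" and x: "x \<in> ?V" for s t x
  proof -
    obtain f where f: "f \<in> Lsq M" "x = L2_embed M f" using x by blast
    have Pf: "P t f \<in> Lsq M" by (rule C0_semigroup_Lsq[OF sg t f(1)])
    have "AE x in M. P (s + t) f x = P s (P t f) x" using sg s t f unfolding C0_semigroup_def by blast
    then have "L2_embed M (P (s + t) f) = L2_embed M (P s (P t f))"
      using L2_embed_eq_iff[OF C0_semigroup_Lsq[OF sg _ f(1)] C0_semigroup_Lsq[OF sg s Pf]] s t by simp
    then show ?thesis using s t by (simp add: L2_semigroup_embed[OF sg] f Pf)
  qed
  show "((\<lambda>t. ?T t x) \<longlongrightarrow> x) (at_right 0)" if x: "x \<in> ?V" for x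
  proof -
    obtain f where f: "f \<in> Lsq M" "x = L2_embed M f" using x by blast
    have "((\<lambda>t. L2_embed M (P t f)) \<longlongrightarrow> L2_embed M f) (at_right 0)"
      using sg f unfolding C0_semigroup_def Lsq_tendsto_iff_L2_embed by blast
    moreover have "\<forall>\<^sub>F t in at_right 0. L2_embed M (P t f) = ?T t (L2_embed M f)"
      by (simp add: eventually_at_filter L2_semigroup_embed[OF sg] f)
    ultimately show ?thesis unfolding f(2) by (rule Lim_transform_eventually)
  qed
qed

lemma L2_embed_quotient:
  fixes f g :: "'a \<Rightarrow> real"
  assumes "f \<in> Lsq M" "g \<in> Lsq M"
  shows "(\<lambda>x. (f x - g x) / c) \<in> Lsq M"
    and "L2_embed M (\<lambda>x. (f x - g x) / c) = (1 / c) *\<^sub>R (L2_embed M f - L2_embed M g)"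
  using Lsq_scale[OF Lsq_diff[OF assms], of "1 / c"] L2_embed_scale[OF Lsq_diff[OF assms], of "1 / c"]
    L2_embed_diff[OF assms] by simp_all

lemma generator_iff_L2_semigroup:
  assumes sg: "C0_semigroup M P"
  shows "(f, g) \<in> generator M P \<longleftrightarrow> f \<in> Lsq M \<and> g \<in> Lsq M \<and>
    subspace_semigroup.generator_maps (L2_embed M ` Lsq M) (L2_semigroup M P) (L2_embed M f) (L2_embed M g)"
proof -
  interpret S: subspace_semigroup "L2_embed M ` Lsq M" "L2_semigroup M P"
    by (rule subspace_semigroup_L2[OF sg])
  have "Lsq_tendsto M (\<lambda>t x. (P t f x - f x) / t) g (at_right 0) \<longleftrightarrow> g \<in> Lsq M \<and>
     ((\<lambda>t. (1 / t) *\<^sub>R (L2_semigroup M P t (L2_embed M f) - L2_embed M f)) \<longlongrightarrow> L2_embed M g) (at_right 0)"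
    if f: "f \<in> Lsq M"
  proof -
    have "\<forall>\<^sub>F t in at_right 0. (\<lambda>x. (P t f x - f x) / t) \<in> Lsq M"
      by (simp add: eventually_at_filter L2_embed_quotient C0_semigroup_Lsq[OF sg] f)
    moreover have "\<forall>\<^sub>F t in at_right 0. L2_embed M (\<lambda>x. (P t f x - f x) / t)
        = (1 / t) *\<^sub>R (L2_semigroup M P t (L2_embed M f) - L2_embed M f)"
      by (simp add: eventually_at_filter L2_embed_quotient C0_semigroup_Lsq[OF sg] f L2_semigroup_embed[OF sg])
    ultimately show ?thesis
      unfolding Lsq_tendsto_iff_L2_embed using tendsto_cong by fast
  qed
  then show ?thesis unfolding generator_def S.generator_maps_def by auto
qed

lemma generator_orbit:
  assumes sg: "C0_semigroup M P" and fg: "(f, g) \<in> generator M P" and t: "t \<ge> 0"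
  shows "(P t f, P t g) \<in> generator M P"
proof -
  interpret S: subspace_semigroup "L2_embed M ` Lsq M" "L2_semigroup M P"
    by (rule subspace_semigroup_L2[OF sg])
  have f: "f \<in> Lsq M" and g: "g \<in> Lsq M"
    and gen: "S.generator_maps (L2_embed M f) (L2_embed M g)"
    using fg unfolding generator_iff_L2_semigroup[OF sg] by auto
  show ?thesis
    using S.generator_maps_orbit[OF gen t] unfolding generator_iff_L2_semigroup[OF sg]
    by (simp add: L2_semigroup_embed[OF sg t] C0_semigroup_Lsq[OF sg t] f g)
qed

lemma semigroup_Lsq_continuous:
  assumes sg: "C0_semigroup M P" and f: "f \<in> Lsq M" and t: "t \<ge> 0"
  shows "Lsq_tendsto M (\<lambda>s. P s f) (P t f) (at t within {0..})"
proof -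
  interpret S: subspace_semigroup "L2_embed M ` Lsq M" "L2_semigroup M P"
    by (rule subspace_semigroup_L2[OF sg])
  have "((\<lambda>s. L2_semigroup M P s (L2_embed M f)) \<longlongrightarrow> L2_embed M (P t f)) (at t within {0..})"
    using S.orbit_tendsto[OF t, of "L2_embed M f"] f by (simp add: L2_semigroup_embed[OF sg t])
  moreover have "\<forall>\<^sub>F s in at t within {0..}. L2_semigroup M P s (L2_embed M f) = L2_embed M (P s f)"
    by (simp add: eventually_at_filter L2_semigroup_embed[OF sg] f)
  ultimately have "((\<lambda>s. L2_embed M (P s f)) \<longlongrightarrow> L2_embed M (P t f)) (at t within {0..})"
    by (rule Lim_transform_eventually)
  then show ?thesis
    unfolding Lsq_tendsto_iff_L2_embed
    by (simp add: eventually_at_filter C0_semigroup_Lsq[OF sg] f t)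
qed

lemma semigroup_Lsq_derivative:
  assumes sg: "C0_semigroup M P" and fg: "(f, g) \<in> generator M P" and t: "t > 0"
  shows "Lsq_tendsto M (\<lambda>s x. (P s f x - P t f x) / (s - t)) (P t g) (at t)"
proof -
  interpret S: subspace_semigroup "L2_embed M ` Lsq M" "L2_semigroup M P"
    by (rule subspace_semigroup_L2[OF sg])
  have f: "f \<in> Lsq M" and g: "g \<in> Lsq M"
    and gen: "S.generator_maps (L2_embed M f) (L2_embed M g)"
    using fg unfolding generator_iff_L2_semigroup[OF sg] by auto
  have at: "at t within {0..} = at t" using t by (intro at_within_interior) (simp add: interior_Ici)
  have pos: "\<forall>\<^sub>F s in at t. s > 0"
    by (rule order_tendstoD(1)[OF tendsto_ident_at t])
  have "((\<lambda>s. (1 / (s - t)) *\<^sub>R (L2_semigroup M P s (L2_embed M f) - L2_semigroup M P t (L2_embed M f)))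
      \<longlongrightarrow> L2_embed M (P t g)) (at t)"
    using S.orbit_has_derivative[OF gen, of t] t
    unfolding has_vector_derivative_iff_quotient_tendsto at
    by (simp add: L2_semigroup_embed[OF sg] g)
  moreover have "\<forall>\<^sub>F s in at t.
      (1 / (s - t)) *\<^sub>R (L2_semigroup M P s (L2_embed M f) - L2_semigroup M P t (L2_embed M f))
      = L2_embed M (\<lambda>x. (P s f x - P t f x) / (s - t))"
    using pos
    by eventually_elim
       (use t in \<open>simp add: L2_embed_quotient C0_semigroup_Lsq[OF sg] f L2_semigroup_embed[OF sg]\<close>)
  ultimately have "((\<lambda>s. L2_embed M (\<lambda>x. (P s f x - P t f x) / (s - t))) \<longlongrightarrow> L2_embed M (P t g)) (at t)"
    by (rule Lim_transform_eventually)
  moreover have "\<forall>\<^sub>F s in at t. (\<lambda>x. (P s f x - P t f x) / (s - t)) \<in> Lsq M"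
    using pos by eventually_elim (use t in \<open>simp add: L2_embed_quotient C0_semigroup_Lsq[OF sg] f\<close>)
  ultimately show ?thesis
    unfolding Lsq_tendsto_iff_L2_embed using C0_semigroup_Lsq[OF sg _ g] t by simp
qed

lemma generator_domain_dense:
  assumes sg: "C0_semigroup M P" and f: "f \<in> Lsq M" and \<epsilon>: "\<epsilon> > 0"
  obtains h g where "(h, g) \<in> generator M P" "Lsq_norm M (\<lambda>x. h x - f x) < \<epsilon>"
proof -
  interpret S: subspace_semigroup "L2_embed M ` Lsq M" "L2_semigroup M P"
    by (rule subspace_semigroup_L2[OF sg])
  obtain z y where zy: "S.generator_maps z y" "norm (z - L2_embed M f) < \<epsilon>"
    using S.gen_domain_dense[OF _ \<epsilon>, of "L2_embed M f"] f by blast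
  then obtain h g where hg: "h \<in> Lsq M" "g \<in> Lsq M" "z = L2_embed M h" "y = L2_embed M g"
    unfolding S.generator_maps_def by blast
  show thesis
  proof (rule that)
    show "(h, g) \<in> generator M P" unfolding generator_iff_L2_semigroup[OF sg] using zy hg by simp
    show "Lsq_norm M (\<lambda>x. h x - f x) < \<epsilon>"
      using zy(2) hg norm_L2_embed[OF Lsq_diff[OF hg(1) f]] by (simp add: L2_embed_diff f)
  qed
qed

text \<open>
  The orbit of \<open>f\<close> has derivative \<open>P t 0 = 0\<close>.
\<close>

lemma semigroup_fixes_kernel:
  assumes sg: "C0_semigroup M P" and f: "(f, \<lambda>x. 0) \<in> generator M P" and t: "t \<ge> 0"
  shows "AE x in M. P t f x = f x"
proof -
  interpret S: subspace_semigroup "L2_embed M ` Lsq M" "L2_semigroup M P"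
    by (rule subspace_semigroup_L2[OF sg])
  have fL: "f \<in> Lsq M" and gen: "S.generator_maps (L2_embed M f) (L2_embed M (\<lambda>x. 0))"
    using f unfolding generator_iff_L2_semigroup[OF sg] by auto
  have "L2_embed M (\<lambda>x. 0) = 0" using L2_embed_scale[OF Lsq_zero, of M 0] by simp
  then have "L2_embed M (P t f) = L2_embed M f"
    using S.orbit_const_if_gen_0[OF _ t, of "L2_embed M f"] gen by (simp add: L2_semigroup_embed[OF sg t fL])
  then show ?thesis using L2_embed_eq_iff[OF C0_semigroup_Lsq[OF sg t fL] fL] by blast
qed

end

section \<open>Continuity of integral functionals on \<open>L\<^sup>2(M)\<close>\<close>

lemma Lsq_norm_mono:
  fixes h k :: "'a \<Rightarrow> real"
  assumes h: "h \<in> borel_measurable M" and k: "k \<in> Lsq M" and le: "\<And>x. \<bar>h x\<bar> \<le> C * \<bar>k x\<bar>"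
    and C: "0 \<le> C"
  shows "h \<in> Lsq M" and "Lsq_norm M h \<le> C * Lsq_norm M k"
proof -
  have sq: "(h x)\<^sup>2 \<le> C\<^sup>2 * (k x)\<^sup>2" for x
    using power_mono[OF le[of x], of 2] by (simp add: power_mult_distrib)
  have int: "integrable M (\<lambda>x. C\<^sup>2 * (k x)\<^sup>2)" using k unfolding Lsq_real_iff by simp
  have "integrable M (\<lambda>x. (h x)\<^sup>2)"
    by (rule Bochner_Integration.integrable_bound[OF int]) (use h sq in auto)
  then show hL: "h \<in> Lsq M" using h unfolding Lsq_real_iff by blast
  have "(Lsq_norm M h)\<^sup>2 \<le> (\<integral>x. C\<^sup>2 * (k x)\<^sup>2 \<partial>M)"
    unfolding Lsq_norm_sq using hL int sq unfolding Lsq_real_iff by (intro integral_mono) auto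
  also have "\<dots> = (C * Lsq_norm M k)\<^sup>2" by (simp add: power_mult_distrib Lsq_norm_sq)
  finally show "Lsq_norm M h \<le> C * Lsq_norm M k" by (rule power2_le_imp_le) (simp add: C)
qed

lemma Lsq_tendsto_const: "f \<in> Lsq M \<Longrightarrow> Lsq_tendsto M (\<lambda>i. f) f F" for f :: "'a \<Rightarrow> real"
  unfolding Lsq_tendsto_iff_L2_embed by simp

text \<open>
  Continuity of the inner product, from
  \<open>fs gs - f g = fs (gs - g) + (fs - f) g\<close> and the Cauchy-Schwarz inequality.
\<close>

lemma Lsq_tendsto_integral_mult:
  fixes f g :: "'a \<Rightarrow> real"
  assumes f: "Lsq_tendsto M fs f F" and g: "Lsq_tendsto M gs g F"
  shows "((\<lambda>i. \<integral>x. fs i x * gs i x \<partial>M) \<longlongrightarrow> (\<integral>x. f x * g x \<partial>M)) F"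
proof (rule LIM_zero_cancel, rule Lim_null_comparison)
  have fL: "f \<in> Lsq M" "\<forall>\<^sub>F i in F. fs i \<in> Lsq M" and gL: "g \<in> Lsq M" "\<forall>\<^sub>F i in F. gs i \<in> Lsq M"
    and df: "((\<lambda>i. Lsq_norm M (\<lambda>x. fs i x - f x)) \<longlongrightarrow> 0) F"
    and dg: "((\<lambda>i. Lsq_norm M (\<lambda>x. gs i x - g x)) \<longlongrightarrow> 0) F"
    using f g unfolding Lsq_tendsto_def by auto
  let ?b = "\<lambda>i. norm (L2_embed M (fs i)) * Lsq_norm M (\<lambda>x. gs i x - g x)
      + Lsq_norm M (\<lambda>x. fs i x - f x) * Lsq_norm M g"
  have "((\<lambda>i. L2_embed M (fs i)) \<longlongrightarrow> L2_embed M f) F"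
    using f unfolding Lsq_tendsto_iff_L2_embed by blast
  then have "(?b \<longlongrightarrow> norm (L2_embed M f) * 0 + 0 * Lsq_norm M g) F"
    by (intro tendsto_intros df dg)
  then show "(?b \<longlongrightarrow> 0) F" by simp
  show "\<forall>\<^sub>F i in F. norm ((\<integral>x. fs i x * gs i x \<partial>M) - (\<integral>x. f x * g x \<partial>M)) \<le> ?b i"
    using fL(2) gL(2)
  proof eventually_elim
    case (elim i)
    have "(\<integral>x. fs i x * gs i x \<partial>M) - (\<integral>x. f x * g x \<partial>M)
        = (\<integral>x. fs i x * (gs i x - g x) \<partial>M) + (\<integral>x. (fs i x - f x) * g x \<partial>M)"
      using Lsq_mult_integrable[OF elim] Lsq_mult_integrable[OF elim(1) gL(1)] Lsq_mult_integrable[OF fL(1) gL(1)]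
      by (simp add: right_diff_distrib left_diff_distrib)
    moreover have "\<bar>\<integral>x. fs i x * (gs i x - g x) \<partial>M\<bar> \<le> Lsq_norm M (fs i) * Lsq_norm M (\<lambda>x. gs i x - g x)"
      by (rule Lsq_Cauchy_Schwarz[OF elim(1) Lsq_diff[OF elim(2) gL(1)]])
    moreover have "\<bar>\<integral>x. (fs i x - f x) * g x \<partial>M\<bar> \<le> Lsq_norm M (\<lambda>x. fs i x - f x) * Lsq_norm M g"
      by (rule Lsq_Cauchy_Schwarz[OF Lsq_diff[OF elim(1) fL(1)] gL(1)])
    ultimately show ?case unfolding norm_L2_embed[OF elim(1)] real_norm_def by linarith
  qed
qed

context finite_measure
begin

lemma Lsq_lipschitz_comp:
  fixes b :: "real \<Rightarrow> real"
  assumes b: "C-lipschitz_on UNIV b" and f: "f \<in> Lsq M"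
  shows "(\<lambda>x. b (f x)) \<in> Lsq M"
proof -
  have bm: "b \<in> borel_measurable borel"
    by (rule borel_measurable_continuous_onI[OF lipschitz_on_continuous_on[OF b]])
  have "(\<lambda>x. b (f x) - b 0) \<in> Lsq M"
  proof (rule Lsq_norm_mono(1)[OF _ f])
    show "(\<lambda>x. b (f x) - b 0) \<in> borel_measurable M"
      using f bm unfolding Lsq_def by auto
    show "\<bar>b (f x) - b 0\<bar> \<le> C * \<bar>f x\<bar>" for x
      using lipschitz_onD[OF b, of "f x" 0] by (simp add: dist_real_def)
    show "0 \<le> C" by (rule lipschitz_on_nonneg[OF b])
  qed
  from Lsq_lincomb[OF this Lsq_const, of 1 1 "b 0"] show ?thesis by simp
qed

lemma Lsq_tendsto_lipschitz_comp:
  fixes b :: "real \<Rightarrow> real"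
  assumes b: "C-lipschitz_on UNIV b" and f: "Lsq_tendsto M fs f F"
  shows "Lsq_tendsto M (\<lambda>i x. b (fs i x)) (\<lambda>x. b (f x)) F"
  unfolding Lsq_tendsto_def
proof (intro conjI)
  have fL: "f \<in> Lsq M" and fs: "\<forall>\<^sub>F i in F. fs i \<in> Lsq M"
    and df: "((\<lambda>i. Lsq_norm M (\<lambda>x. fs i x - f x)) \<longlongrightarrow> 0) F"
    using f unfolding Lsq_tendsto_def by auto
  show "(\<lambda>x. b (f x)) \<in> Lsq M" by (rule Lsq_lipschitz_comp[OF b fL])
  show "\<forall>\<^sub>F i in F. (\<lambda>x. b (fs i x)) \<in> Lsq M"
    using fs by eventually_elim (rule Lsq_lipschitz_comp[OF b])
  show "((\<lambda>i. Lsq_norm M (\<lambda>x. b (fs i x) - b (f x))) \<longlongrightarrow> 0) F"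
  proof (rule Lim_null_comparison)
    show "((\<lambda>i. C * Lsq_norm M (\<lambda>x. fs i x - f x)) \<longlongrightarrow> 0) F"
      by (rule tendsto_mult_right_zero[OF df])
    show "\<forall>\<^sub>F i in F. norm (Lsq_norm M (\<lambda>x. b (fs i x) - b (f x))) \<le> C * Lsq_norm M (\<lambda>x. fs i x - f x)"
      using fs
    proof eventually_elim
      case (elim i)
      have "Lsq_norm M (\<lambda>x. b (fs i x) - b (f x)) \<le> C * Lsq_norm M (\<lambda>x. fs i x - f x)"
      proof (rule Lsq_norm_mono(2)[OF _ Lsq_diff[OF elim fL]])
        show "(\<lambda>x. b (fs i x) - b (f x)) \<in> borel_measurable M"
          using Lsq_diff[OF Lsq_lipschitz_comp[OF b elim] Lsq_lipschitz_comp[OF b fL]] unfolding Lsq_def by blast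
        show "\<bar>b (fs i x) - b (f x)\<bar> \<le> C * \<bar>fs i x - f x\<bar>" for x
          using lipschitz_onD[OF b, of "fs i x" "f x"] by (simp add: dist_real_def)
        show "0 \<le> C" by (rule lipschitz_on_nonneg[OF b])
      qed
      then show ?case by simp
    qed
  qed
qed

lemma Lsq_tendsto_integral:
  fixes f :: "'a \<Rightarrow> real"
  assumes "Lsq_tendsto M fs f F"
  shows "((\<lambda>i. \<integral>x. fs i x \<partial>M) \<longlongrightarrow> (\<integral>x. f x \<partial>M)) F"
  using Lsq_tendsto_integral_mult[OF assms Lsq_tendsto_const[of "\<lambda>x. 1"]] by simp

end

section \<open>Growth of convex functionals along a semigroup\<close>

text \<open>
  The functions \<open>\<beta>\<close> for which \<open>f \<mapsto> \<integral> \<beta>(f)\<close> can be followed along the semigroup. The bounds \<open>L\<close> and \<open>K\<close> make \<open>\<beta>\<close>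
  and \<open>\<beta>'\<close> Lipschitz, so that composition with them is continuous on \<open>L\<^sup>2\<close>.
\<close>

locale smooth_convex =
  fixes \<beta> \<beta>' \<beta>'' :: "real \<Rightarrow> real" and L K :: real
  assumes deriv: "(\<beta> has_real_derivative \<beta>' s) (at s)"
    and deriv2: "(\<beta>' has_real_derivative \<beta>'' s) (at s)"
    and continuous2: "continuous_on UNIV \<beta>''"
    and nonneg: "0 \<le> \<beta> s" and convex: "0 \<le> \<beta>'' s"
    and deriv_le: "\<bar>\<beta>' s\<bar> \<le> L" and deriv2_le: "\<beta>'' s \<le> K"
begin

lemma lipschitz: "L-lipschitz_on UNIV \<beta>"
proof (rule lipschitz_onI)
  show "dist (\<beta> x) (\<beta> y) \<le> L * dist x y" for x y
    using field_differentiable_bound[of UNIV \<beta> \<beta>' L x y] deriv deriv_le by (simp add: dist_norm)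
  show "0 \<le> L" using deriv_le[of 0] by linarith
qed

lemma deriv_lipschitz: "K-lipschitz_on UNIV \<beta>'"
proof (rule lipschitz_onI)
  show "dist (\<beta>' x) (\<beta>' y) \<le> K * dist x y" for x y
    using field_differentiable_bound[of UNIV \<beta>' \<beta>'' K x y] deriv2 convex deriv2_le
    by (simp add: dist_norm)
  show "0 \<le> K" using convex[of 0] deriv2_le[of 0] by linarith
qed

lemma above_tangent: "\<beta>' a * (b - a) \<le> \<beta> b - \<beta> a"
  by (rule f''_imp_f'[of UNIV \<beta> \<beta>' \<beta>'']) (simp_all add: deriv deriv2 convex)

lemma below_tangent: "\<beta> b - \<beta> a \<le> \<beta>' b * (b - a)"
  using above_tangent[of b a] by (simp add: algebra_simps)

end

context finite_measure
begin

text \<open>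
  By convexity, \<open>\<beta>(P\<^sub>s f) - \<beta>(P\<^sub>t f)\<close> lies between \<open>\<beta>'(P\<^sub>t f) (P\<^sub>s f - P\<^sub>t f)\<close> and \<open>\<beta>'(P\<^sub>s f) (P\<^sub>s f - P\<^sub>t f)\<close>. The
  difference quotient of the integral is therefore squeezed between \<open>A s\<close> and \<open>B s\<close> below, which are inner
  products of \<open>L\<^sup>2\<close>-convergent factors and have the same limit.
\<close>

lemma semigroup_convex_integral_derivative:
  assumes sg: "C0_semigroup M P" and \<beta>: "smooth_convex \<beta> \<beta>' \<beta>'' L K"
    and fg: "(f, g) \<in> generator M P" and t: "t > 0"
  shows "((\<lambda>t. \<integral>x. \<beta> (P t f x) \<partial>M) has_real_derivative (\<integral>x. \<beta>' (P t f x) * P t g x \<partial>M)) (at t)"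
proof -
  interpret \<beta>: smooth_convex \<beta> \<beta>' \<beta>'' L K by (rule \<beta>)
  have f: "f \<in> Lsq M" and g: "g \<in> Lsq M"
    using fg unfolding generator_iff_L2_semigroup[OF sg] by auto
  define q where "q s = (\<lambda>x. (P s f x - P t f x) / (s - t))" for s
  define A where "A s = (\<integral>x. \<beta>' (P t f x) * q s x \<partial>M)" for s
  define B where "B s = (\<integral>x. \<beta>' (P s f x) * q s x \<partial>M)" for s
  define S where "S s = ((\<integral>x. \<beta> (P s f x) \<partial>M) - (\<integral>x. \<beta> (P t f x) \<partial>M)) / (s - t)" for s
  define D where "D = (\<integral>x. \<beta>' (P t f x) * P t g x \<partial>M)"
  have Pt: "P t f \<in> Lsq M" using C0_semigroup_Lsq[OF sg _ f] t by simp
  have q: "Lsq_tendsto M q (P t g) (at t)"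
    unfolding q_def by (rule semigroup_Lsq_derivative[OF sg fg t])
  have at: "at t within {0..} = at t" using t by (intro at_within_interior) simp
  have Ps: "Lsq_tendsto M (\<lambda>s. P s f) (P t f) (at t)"
    using semigroup_Lsq_continuous[OF sg f, of t] t unfolding at by simp
  have A: "(A \<longlongrightarrow> D) (at t)"
    unfolding A_def D_def
    by (rule Lsq_tendsto_integral_mult[OF Lsq_tendsto_const[OF Lsq_lipschitz_comp[OF \<beta>.deriv_lipschitz Pt]] q])
  have B: "(B \<longlongrightarrow> D) (at t)"
    unfolding B_def D_def
    by (rule Lsq_tendsto_integral_mult[OF Lsq_tendsto_lipschitz_comp[OF \<beta>.deriv_lipschitz Ps] q])
  have "\<forall>\<^sub>F s in at t. s > 0" by (rule order_tendstoD(1)[OF tendsto_ident_at t])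
  moreover have "\<forall>\<^sub>F s in at t. s \<noteq> t" by (simp add: eventually_at_filter)
  ultimately have "\<forall>\<^sub>F s in at t. min (A s) (B s) \<le> S s \<and> S s \<le> max (A s) (B s)"
  proof eventually_elim
    case (elim s)
    have P: "P s f \<in> Lsq M" using C0_semigroup_Lsq[OF sg _ f] elim by simp
    have qs: "q s \<in> Lsq M" unfolding q_def by (rule L2_embed_quotient(1)[OF P Pt])
    have \<beta>P: "integrable M (\<lambda>x. \<beta> (P s f x))" "integrable M (\<lambda>x. \<beta> (P t f x))"
      by (intro Lsq_integrable Lsq_lipschitz_comp[OF \<beta>.lipschitz] P Pt)+
    have \<beta>'P: "integrable M (\<lambda>x. \<beta>' (P t f x) * q s x)" "integrable M (\<lambda>x. \<beta>' (P s f x) * q s x)"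
      by (intro Lsq_mult_integrable qs Lsq_lipschitz_comp[OF \<beta>.deriv_lipschitz] P Pt)+
    have S: "S s = (\<integral>x. (\<beta> (P s f x) - \<beta> (P t f x)) / (s - t) \<partial>M)"
      unfolding S_def using \<beta>P by simp
    have int: "integrable M (\<lambda>x. (\<beta> (P s f x) - \<beta> (P t f x)) / (s - t))" using \<beta>P by simp
    have up: "\<beta> (P s f x) - \<beta> (P t f x) \<le> \<beta>' (P s f x) * (P s f x - P t f x)"
      and lo: "\<beta>' (P t f x) * (P s f x - P t f x) \<le> \<beta> (P s f x) - \<beta> (P t f x)" for x
      by (rule \<beta>.below_tangent \<beta>.above_tangent)+
    show ?case
    proof (cases "s > t")
      case True
      have "A s \<le> S s" unfolding A_def S
        by (intro integral_mono \<beta>'P int) (use divide_right_mono[OF lo, of "s - t"] True in \<open>simp add: q_def\<close>)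
      moreover have "S s \<le> B s" unfolding B_def S
        by (intro integral_mono \<beta>'P int) (use divide_right_mono[OF up, of "s - t"] True in \<open>simp add: q_def\<close>)
      ultimately show ?thesis by simp
    next
      case False
      then have st: "s - t \<le> 0" by simp
      have "S s \<le> A s" unfolding A_def S
        by (intro integral_mono \<beta>'P int) (use divide_right_mono_neg[OF lo st] in \<open>simp add: q_def\<close>)
      moreover have "B s \<le> S s" unfolding B_def S
        by (intro integral_mono \<beta>'P int) (use divide_right_mono_neg[OF up st] in \<open>simp add: q_def\<close>)
      ultimately show ?thesis by simp
    qed
  qed
  then have lower: "\<forall>\<^sub>F s in at t. min (A s) (B s) \<le> S s" and upper: "\<forall>\<^sub>F s in at t. S s \<le> max (A s) (B s)"
    by (auto elim: eventually_mono)
  have "((\<lambda>s. min (A s) (B s)) \<longlongrightarrow> D) (at t)" "((\<lambda>s. max (A s) (B s)) \<longlongrightarrow> D) (at t)"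
    using tendsto_min[OF A B] tendsto_max[OF A B] by simp_all
  then have "(S \<longlongrightarrow> D) (at t)"
    by (rule tendsto_sandwich[OF lower upper])
  then show ?thesis unfolding has_field_derivative_iff S_def D_def .
qed

text \<open>
  Gronwall's lemma on the domain of the generator; both sides are continuous in \<open>f\<close>, so the bound
  extends to all of \<open>L\<^sup>2\<close> by density.
\<close>

lemma semigroup_convex_integral_growth:
  assumes sg: "C0_semigroup M P" and \<beta>: "smooth_convex \<beta> \<beta>' \<beta>'' L K"
    and dissip: "\<And>f g. (f, g) \<in> generator M P \<Longrightarrow> (\<integral>x. \<beta>' (f x) * g x \<partial>M) \<le> c * (\<integral>x. \<beta> (f x) \<partial>M)"
    and f: "f \<in> Lsq M" and t: "t \<ge> 0"
  shows "(\<integral>x. \<beta> (P t f x) \<partial>M) \<le> exp (c * t) * (\<integral>x. \<beta> (f x) \<partial>M)"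
proof -
  interpret \<beta>: smooth_convex \<beta> \<beta>' \<beta>'' L K by (rule \<beta>)
  have domain: "(\<integral>x. \<beta> (P t h x) \<partial>M) \<le> exp (c * t) * (\<integral>x. \<beta> (h x) \<partial>M)"
    if hg: "(h, g) \<in> generator M P" for h g
  proof -
    have h: "h \<in> Lsq M" using hg unfolding generator_iff_L2_semigroup[OF sg] by blast
    define F where "F s = (\<integral>x. \<beta> (P s h x) \<partial>M)" for s
    have F0: "F 0 = (\<integral>x. \<beta> (h x) \<partial>M)"
    proof -
      have P0: "P 0 h \<in> Lsq M" by (rule C0_semigroup_Lsq[OF sg order_refl h])
      have "AE x in M. P 0 h x = h x" using sg h unfolding C0_semigroup_def by blast
      then show ?thesis unfolding F_def
        using Lsq_lipschitz_comp[OF \<beta>.lipschitz h] Lsq_lipschitz_comp[OF \<beta>.lipschitz P0]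
        by (intro integral_cong_AE) (auto simp: Lsq_def)
    qed
    have "exp (- c * t) * F t \<le> exp (- c * 0) * F 0"
    proof (rule DERIV_nonpos_imp_decreasing_open[OF t])
      fix s assume s: "0 < s" "s < t"
      have "(F has_real_derivative (\<integral>x. \<beta>' (P s h x) * P s g x \<partial>M)) (at s)"
        unfolding F_def by (rule semigroup_convex_integral_derivative[OF sg \<beta> hg s(1)])
      then have "((\<lambda>s. exp (- c * s) * F s) has_real_derivative
          exp (- c * s) * ((\<integral>x. \<beta>' (P s h x) * P s g x \<partial>M) - c * F s)) (at s)"
        by (auto intro!: derivative_eq_intros simp: algebra_simps)
      moreover have "(\<integral>x. \<beta>' (P s h x) * P s g x \<partial>M) - c * F s \<le> 0"
        using dissip[OF generator_orbit[OF sg hg]] s unfolding F_def by simp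
      ultimately show "\<exists>y. ((\<lambda>s. exp (- c * s) * F s) has_real_derivative y) (at s) \<and> y \<le> 0"
        by (intro exI conjI) (auto simp: mult_nonneg_nonpos)
    next
      have "continuous_on {0..} F"
        unfolding continuous_on_def F_def
        using Lsq_tendsto_integral[OF Lsq_tendsto_lipschitz_comp[OF \<beta>.lipschitz semigroup_Lsq_continuous[OF sg h]]]
        by simp
      then show "continuous_on {0..t} (\<lambda>s. exp (- c * s) * F s)"
        by (intro continuous_intros) (auto intro: continuous_on_subset)
    qed
    then have "exp (c * t) * (exp (- c * t) * F t) \<le> exp (c * t) * F 0" by simp
    then show ?thesis unfolding F0[symmetric] unfolding F_def by (simp add: mult.assoc[symmetric] exp_add[symmetric])
  qed
  have "\<forall>n. \<exists>h g. (h, g) \<in> generator M P \<and> Lsq_norm M (\<lambda>x. h x - f x) < inverse (real (Suc n))"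
    using generator_domain_dense[OF sg f] by (metis inverse_positive_iff_positive of_nat_0_less_iff zero_less_Suc)
  then obtain h g where hg: "\<And>n. (h n, g n) \<in> generator M P"
    and hf: "\<And>n. Lsq_norm M (\<lambda>x. h n x - f x) < inverse (real (Suc n))" by metis
  have h: "h n \<in> Lsq M" for n using hg[of n] unfolding generator_iff_L2_semigroup[OF sg] by blast
  have "(\<lambda>n. Lsq_norm M (\<lambda>x. h n x - f x)) \<longlonglongrightarrow> 0"
    by (rule tendsto_sandwich[OF _ _ tendsto_const LIMSEQ_inverse_real_of_nat])
       (use less_imp_le[OF hf] in \<open>auto intro!: always_eventually simp del: of_nat_Suc\<close>)
  then have hlim: "Lsq_tendsto M h f sequentially"
    unfolding Lsq_tendsto_def using f h by simp
  have Ph: "Lsq_tendsto M (\<lambda>n. P t (h n)) (P t f) sequentially"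
  proof -
    obtain C where C: "\<forall>f\<in>Lsq M. norm (L2_embed M (P t f)) \<le> C * norm (L2_embed M f)"
      using L2_embed_semigroup_bounded[OF sg t] by blast
    have le: "norm (L2_embed M (P t (h n)) - L2_embed M (P t f)) \<le> C * norm (L2_embed M (h n) - L2_embed M f)" for n
      using C[rule_format, OF Lsq_lincomb[OF h f, of 1 n "-1"]]
        L2_embed_semigroup_lincomb[OF sg t h f, of 1 n "-1"] L2_embed_lincomb[OF h f, of 1 n "-1"] by simp
    have lim0: "(\<lambda>n. C * norm (L2_embed M (h n) - L2_embed M f)) \<longlonglongrightarrow> 0"
      using hlim unfolding Lsq_tendsto_iff_L2_embed
      by (intro tendsto_mult_right_zero tendsto_norm_zero LIM_zero) blast
    have "(\<lambda>n. L2_embed M (P t (h n)) - L2_embed M (P t f)) \<longlonglongrightarrow> 0"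
      by (rule Lim_null_comparison[OF _ lim0]) (intro always_eventually allI le)
    then have "(\<lambda>n. L2_embed M (P t (h n))) \<longlonglongrightarrow> L2_embed M (P t f)" by (rule LIM_zero_cancel)
    then show ?thesis
      unfolding Lsq_tendsto_iff_L2_embed using C0_semigroup_Lsq[OF sg t] f h by simp
  qed
  show ?thesis
  proof (rule LIMSEQ_le)
    show "(\<lambda>n. \<integral>x. \<beta> (P t (h n) x) \<partial>M) \<longlonglongrightarrow> (\<integral>x. \<beta> (P t f x) \<partial>M)"
      by (rule Lsq_tendsto_integral[OF Lsq_tendsto_lipschitz_comp[OF \<beta>.lipschitz Ph]])
    show "(\<lambda>n. exp (c * t) * (\<integral>x. \<beta> (h n x) \<partial>M)) \<longlonglongrightarrow> exp (c * t) * (\<integral>x. \<beta> (f x) \<partial>M)"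
      by (intro tendsto_intros Lsq_tendsto_integral[OF Lsq_tendsto_lipschitz_comp[OF \<beta>.lipschitz hlim]])
    show "\<exists>N. \<forall>n\<ge>N. (\<integral>x. \<beta> (P t (h n) x) \<partial>M) \<le> exp (c * t) * (\<integral>x. \<beta> (h n x) \<partial>M)"
      using domain[OF hg] by blast
  qed
qed

end

text \<open>
  The condition \<open>\<bar>a\<bar> \<le> 1\<close> keeps the function nonnegative.
\<close>

lemma smooth_convex_sqrt:
  fixes \<epsilon> a :: real
  assumes \<epsilon>: "\<epsilon> > 0" and a: "\<bar>a\<bar> \<le> 1"
  shows "smooth_convex (\<lambda>s. sqrt (s\<^sup>2 + \<epsilon>\<^sup>2) + a * s) (\<lambda>s. s / sqrt (s\<^sup>2 + \<epsilon>\<^sup>2) + a)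
    (\<lambda>s. \<epsilon>\<^sup>2 / (sqrt (s\<^sup>2 + \<epsilon>\<^sup>2)) ^ 3) 2 (1 / \<epsilon>)"
proof
  fix s :: real
  define q where "q = sqrt (s\<^sup>2 + \<epsilon>\<^sup>2)"
  have pos: "s\<^sup>2 + \<epsilon>\<^sup>2 > 0" for s using \<epsilon> by (simp add: add_nonneg_pos)
  have q: "q > 0" unfolding q_def using pos[of s] by simp
  have qq: "q\<^sup>2 = s\<^sup>2 + \<epsilon>\<^sup>2" unfolding q_def using pos[of s] by simp
  have sq: "\<bar>s\<bar> \<le> q" unfolding q_def by (rule real_le_rsqrt) simp
  have eq: "\<epsilon> \<le> q" unfolding q_def by (rule real_le_rsqrt) simp
  have inner: "((\<lambda>s. s\<^sup>2 + \<epsilon>\<^sup>2) has_real_derivative 2 * s) (at s)"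
    using DERIV_add[OF DERIV_pow[of 2 s UNIV] DERIV_const[of "\<epsilon>\<^sup>2"]] by simp
  have dq: "((\<lambda>s. sqrt (s\<^sup>2 + \<epsilon>\<^sup>2)) has_real_derivative s / q) (at s)"
  proof -
    have "inverse (sqrt (s\<^sup>2 + \<epsilon>\<^sup>2)) / 2 * (2 * s) = s / q"
      by (simp add: q_def inverse_eq_divide)
    then show ?thesis
      using DERIV_chain2[where f = sqrt and g = "\<lambda>s. s\<^sup>2 + \<epsilon>\<^sup>2" and x = s, OF DERIV_real_sqrt[OF pos] inner]
      by simp
  qed
  show "((\<lambda>s. sqrt (s\<^sup>2 + \<epsilon>\<^sup>2) + a * s) has_real_derivative s / sqrt (s\<^sup>2 + \<epsilon>\<^sup>2) + a) (at s)"
    using DERIV_add[OF dq DERIV_cmult_Id[of a]] unfolding q_def .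
  have "((\<lambda>s. s / sqrt (s\<^sup>2 + \<epsilon>\<^sup>2) + a) has_real_derivative (1 * q - s * (s / q)) / (q * q) + 0) (at s)"
  proof -
    have "sqrt (s\<^sup>2 + \<epsilon>\<^sup>2) \<noteq> 0" using q unfolding q_def by linarith
    from DERIV_add[OF DERIV_divide[OF DERIV_ident dq this] DERIV_const[of a]]
    show ?thesis unfolding q_def .
  qed
  moreover have "(1 * q - s * (s / q)) / (q * q) + 0 = \<epsilon>\<^sup>2 / q ^ 3"
  proof -
    have "(1 * q - s * (s / q)) / (q * q) + 0 = (q\<^sup>2 - s\<^sup>2) / q ^ 3"
      using q by (simp add: field_simps power2_eq_square power3_eq_cube)
    then show ?thesis by (simp add: qq)
  qed
  ultimately show "((\<lambda>s. s / sqrt (s\<^sup>2 + \<epsilon>\<^sup>2) + a) has_real_derivative \<epsilon>\<^sup>2 / sqrt (s\<^sup>2 + \<epsilon>\<^sup>2) ^ 3) (at s)"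
    unfolding q_def by simp
  show "continuous_on UNIV (\<lambda>s. \<epsilon>\<^sup>2 / sqrt (s\<^sup>2 + \<epsilon>\<^sup>2) ^ 3)"
  proof (intro continuous_intros ballI)
    show "sqrt (s\<^sup>2 + \<epsilon>\<^sup>2) ^ 3 \<noteq> 0" for s using \<epsilon> by auto
  qed
  have as: "\<bar>a * s\<bar> \<le> \<bar>s\<bar>" using a by (simp add: abs_mult mult_left_le_one_le)
  then show "0 \<le> sqrt (s\<^sup>2 + \<epsilon>\<^sup>2) + a * s" using sq unfolding q_def by linarith
  show "0 \<le> \<epsilon>\<^sup>2 / sqrt (s\<^sup>2 + \<epsilon>\<^sup>2) ^ 3" using pos[of s] by simp
  have "\<bar>s / q\<bar> \<le> 1" using sq q by simp
  then show "\<bar>s / sqrt (s\<^sup>2 + \<epsilon>\<^sup>2) + a\<bar> \<le> 2" using a unfolding q_def by linarith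
  have "\<epsilon>\<^sup>2 / q ^ 3 \<le> q\<^sup>2 / q ^ 3" using eq \<epsilon> q by (intro divide_right_mono power_mono) auto
  also have "\<dots> = 1 / q" using q by (simp add: power2_eq_square power3_eq_cube)
  also have "\<dots> \<le> 1 / \<epsilon>" using eq \<epsilon> q by (intro divide_left_mono) auto
  finally show "\<epsilon>\<^sup>2 / sqrt (s\<^sup>2 + \<epsilon>\<^sup>2) ^ 3 \<le> 1 / \<epsilon>" unfolding q_def .
qed

lemma sqrt_regularization_bounds:
  fixes s \<epsilon> :: real
  assumes "\<epsilon> > 0"
  shows "\<bar>s\<bar> \<le> sqrt (s\<^sup>2 + \<epsilon>\<^sup>2)" and "sqrt (s\<^sup>2 + \<epsilon>\<^sup>2) \<le> \<bar>s\<bar> + \<epsilon>"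
  using real_le_rsqrt[of "\<bar>s\<bar>" "s\<^sup>2 + \<epsilon>\<^sup>2"] sqrt_sum_squares_le_sum_abs[of s \<epsilon>] assms by simp_all

text \<open>
  The growth bound for the smooth functions \<open>sqrt (s\<^sup>2 + \<epsilon>\<^sup>2) + a s\<close>, which lie within \<open>\<epsilon>\<close> of
  \<open>\<bar>s\<bar> + a s\<close>. As \<open>M\<close> has total mass \<open>1\<close>, the approximation costs \<open>\<epsilon>\<close> on the right-hand side, which
  becomes \<open>\<epsilon> exp (c t)\<close> after multiplication by the growth factor.
\<close>

lemma (in prob_space) semigroup_abs_integral_growth:
  fixes a c :: real
  assumes sg: "C0_semigroup M P"
    and dissip: "\<And>\<beta> \<beta>' \<beta>'' L K f g. smooth_convex \<beta> \<beta>' \<beta>'' L K \<Longrightarrow> (f, g) \<in> generator M P \<Longrightarrow>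
        (\<integral>x. \<beta>' (f x) * g x \<partial>M) \<le> c * (\<integral>x. \<beta> (f x) \<partial>M)"
    and f: "f \<in> Lsq M" and t: "t \<ge> 0" and a: "\<bar>a\<bar> \<le> 1"
  shows "(\<integral>x. \<bar>P t f x\<bar> + a * P t f x \<partial>M) \<le> exp (c * t) * (\<integral>x. \<bar>f x\<bar> + a * f x \<partial>M)"
proof (rule field_le_epsilon)
  fix \<delta> :: real assume \<delta>: "\<delta> > 0"
  define \<epsilon> where "\<epsilon> = \<delta> / exp (c * t)"
  have \<epsilon>: "\<epsilon> > 0" using \<delta> by (simp add: \<epsilon>_def)
  define \<beta> where "\<beta> s = sqrt (s\<^sup>2 + \<epsilon>\<^sup>2) + a * s" for s
  note sc = smooth_convex_sqrt[OF \<epsilon> a, folded \<beta>_def]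
  have lip: "2-lipschitz_on UNIV \<beta>" by (rule smooth_convex.lipschitz[OF sc])
  have Pf: "P t f \<in> Lsq M" by (rule C0_semigroup_Lsq[OF sg t f])
  have int: "integrable M (\<lambda>x. \<bar>h x\<bar> + a * h x)" "integrable M (\<lambda>x. \<beta> (h x))" if "h \<in> Lsq M" for h
    using Lsq_integrable[OF that] Lsq_integrable[OF Lsq_lipschitz_comp[OF lip that]] by auto
  have bounds: "\<bar>s\<bar> + a * s \<le> \<beta> s" "\<beta> s \<le> \<bar>s\<bar> + a * s + \<epsilon>" for s
    unfolding \<beta>_def using sqrt_regularization_bounds[OF \<epsilon>, of s] by auto
  have "(\<integral>x. \<bar>P t f x\<bar> + a * P t f x \<partial>M) \<le> (\<integral>x. \<beta> (P t f x) \<partial>M)"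
    by (intro integral_mono int Pf bounds)
  also have "\<dots> \<le> exp (c * t) * (\<integral>x. \<beta> (f x) \<partial>M)"
    by (rule semigroup_convex_integral_growth[OF sg sc dissip[OF sc] f t])
  also have "(\<integral>x. \<beta> (f x) \<partial>M) \<le> (\<integral>x. \<bar>f x\<bar> + a * f x + \<epsilon> \<partial>M)"
    by (intro integral_mono int f bounds Bochner_Integration.integrable_add) simp
  also have "\<dots> = (\<integral>x. \<bar>f x\<bar> + a * f x \<partial>M) + \<epsilon>"
    by (subst Bochner_Integration.integral_add[OF int(1)[OF f]]) (simp_all add: prob_space)
  finally show "(\<integral>x. \<bar>P t f x\<bar> + a * P t f x \<partial>M) \<le> exp (c * t) * (\<integral>x. \<bar>f x\<bar> + a * f x \<partial>M) + \<delta>"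
    by (simp add: \<epsilon>_def distrib_left)
qed

section \<open>The chain rule in \<open>C\<^sub>b\<^sup>2(H)\<close>\<close>

lemma Cb2_has_derivative:
  assumes "\<phi> \<in> Cb2"
  shows "(\<phi> has_derivative blinfun_apply (D1 \<phi> x)) (at x)"
    and "(D1 \<phi> has_derivative blinfun_apply (D2 \<phi> x)) (at x)"
proof -
  have 1: "(\<phi> has_derivative frechet_derivative \<phi> (at x)) (at x)"
    and 2: "(D1 \<phi> has_derivative frechet_derivative (D1 \<phi>) (at x)) (at x)"
    using assms unfolding Cb2_def by (auto simp: frechet_derivative_works[symmetric])
  show "(\<phi> has_derivative blinfun_apply (D1 \<phi> x)) (at x)"
    unfolding D1_def bounded_linear_Blinfun_apply[OF has_derivative_bounded_linear[OF 1]] by (rule 1)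
  show "(D1 \<phi> has_derivative blinfun_apply (D2 \<phi> x)) (at x)"
    unfolding D2_def bounded_linear_Blinfun_apply[OF has_derivative_bounded_linear[OF 2]] by (rule 2)
qed

lemma D1_eqI:
  assumes "(\<phi> has_derivative blinfun_apply A) (at x)"
  shows "D1 \<phi> x = A"
  unfolding D1_def frechet_derivative_at[OF assms, symmetric] by (rule blinfun_apply_inverse)

lemma D2_eqI:
  assumes "(D1 \<phi> has_derivative blinfun_apply A) (at x)"
  shows "D2 \<phi> x = A"
  unfolding D2_def frechet_derivative_at[OF assms, symmetric] by (rule blinfun_apply_inverse)

lemma Cb2_continuous:
  assumes "\<phi> \<in> Cb2"
  shows "continuous_on UNIV \<phi>" and "continuous_on UNIV (D1 \<phi>)"
  by (rule has_derivative_continuous_on[OF has_derivative_at_withinI[OF Cb2_has_derivative(1)[OF assms]]]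
      has_derivative_continuous_on[OF has_derivative_at_withinI[OF Cb2_has_derivative(2)[OF assms]]])+

text \<open>
  The closure of the range of \<open>\<phi>\<close> is compact, so \<open>f \<circ> \<phi>\<close> is bounded even if \<open>f\<close> is not.
\<close>

lemma bounded_continuous_comp:
  fixes f :: "real \<Rightarrow> 'b::metric_space"
  assumes "bounded (range \<phi>)" "continuous_on UNIV f"
  shows "bounded (range (\<lambda>x. f (\<phi> x)))"
proof -
  have "compact (f ` closure (range \<phi>))"
    by (rule compact_continuous_image) (use assms in \<open>auto intro: continuous_on_subset simp: compact_closure\<close>)
  moreover have "range (\<lambda>x. f (\<phi> x)) \<subseteq> f ` closure (range \<phi>)"
    using closure_subset[of "range \<phi>"] by blast
  ultimately show ?thesis using compact_imp_bounded bounded_subset by blast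
qed

lemma
  shows Cb2_const: "(\<lambda>x :: 'h::real_normed_vector. c) \<in> Cb2"
    and D1_const: "D1 (\<lambda>x :: 'h. c) = (\<lambda>x. 0)"
    and D2_const: "D2 (\<lambda>x :: 'h. c) = (\<lambda>x. 0)"
proof -
  show d1: "D1 (\<lambda>x :: 'h. c) = (\<lambda>x. 0)"
    by (intro ext D1_eqI) (simp add: zero_blinfun.rep_eq)
  show d2: "D2 (\<lambda>x :: 'h. c) = (\<lambda>x. 0)"
    by (intro ext D2_eqI) (simp add: d1 zero_blinfun.rep_eq)
  show "(\<lambda>x :: 'h. c) \<in> Cb2" unfolding Cb2_def by (simp add: d1 d2)
qed

lemma
  fixes \<phi> :: "'h::real_normed_vector \<Rightarrow> real"
  assumes \<phi>: "\<phi> \<in> Cb2"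
    and d1: "\<And>s. (\<beta> has_real_derivative \<beta>' s) (at s)"
    and d2: "\<And>s. (\<beta>' has_real_derivative \<beta>'' s) (at s)"
    and cont: "continuous_on UNIV \<beta>''"
  shows Cb2_comp: "(\<lambda>x. \<beta> (\<phi> x)) \<in> Cb2"
    and D1_comp: "D1 (\<lambda>x. \<beta> (\<phi> x)) x = \<beta>' (\<phi> x) *\<^sub>R D1 \<phi> x"
    and D2_comp: "D2 (\<lambda>x. \<beta> (\<phi> x)) x = \<beta>' (\<phi> x) *\<^sub>R D2 \<phi> x
        + \<beta>'' (\<phi> x) *\<^sub>R (blinfun_scaleR_left (D1 \<phi> x) o\<^sub>L D1 \<phi> x)"
proof -
  let ?A = "\<lambda>x. \<beta>' (\<phi> x) *\<^sub>R D2 \<phi> x + \<beta>'' (\<phi> x) *\<^sub>R (blinfun_scaleR_left (D1 \<phi> x) o\<^sub>L D1 \<phi> x)"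
  note D\<phi> = Cb2_has_derivative[OF \<phi>] and C\<phi> = Cb2_continuous[OF \<phi>]
  have bnd: "bounded (range \<phi>)" "bounded (range (D1 \<phi>))" "bounded (range (D2 \<phi>))"
    and contD2: "continuous_on UNIV (D2 \<phi>)"
    using \<phi> unfolding Cb2_def by auto
  have der1: "((\<lambda>x. \<beta> (\<phi> x)) has_derivative blinfun_apply (\<beta>' (\<phi> x) *\<^sub>R D1 \<phi> x)) (at x)" for x
    using has_derivative_compose[OF D\<phi>(1) d1[of "\<phi> x", unfolded has_field_derivative_def]]
    by (simp add: scaleR_blinfun.rep_eq)
  show D1: "D1 (\<lambda>x. \<beta> (\<phi> x)) x = \<beta>' (\<phi> x) *\<^sub>R D1 \<phi> x" for x by (rule D1_eqI[OF der1])
  have \<beta>'\<phi>: "((\<lambda>x. \<beta>' (\<phi> x)) has_derivative (\<lambda>h. \<beta>'' (\<phi> x) * D1 \<phi> x h)) (at x)" for x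
    using has_derivative_compose[OF D\<phi>(1) d2[of "\<phi> x", unfolded has_field_derivative_def]] .
  have "((\<lambda>x. \<beta>' (\<phi> x) *\<^sub>R D1 \<phi> x) has_derivative
      (\<lambda>h. \<beta>' (\<phi> x) *\<^sub>R D2 \<phi> x h + (\<beta>'' (\<phi> x) * D1 \<phi> x h) *\<^sub>R D1 \<phi> x)) (at x)" for x
    using has_derivative_scaleR[OF \<beta>'\<phi>[of x] D\<phi>(2)[of x]] .
  then have der2: "(D1 (\<lambda>x. \<beta> (\<phi> x)) has_derivative blinfun_apply (?A x)) (at x)" for x
    unfolding D1[abs_def] by (simp add: plus_blinfun.rep_eq scaleR_blinfun.rep_eq)
  show D2: "D2 (\<lambda>x. \<beta> (\<phi> x)) x = ?A x" for x by (rule D2_eqI[OF der2])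
  have cb: "continuous_on UNIV \<beta>" "continuous_on UNIV \<beta>'"
    by (rule DERIV_continuous_on[OF has_field_derivative_at_within[OF d1]]
          DERIV_continuous_on[OF has_field_derivative_at_within[OF d2]])+
  have "continuous_on UNIV (\<lambda>x. \<beta>' (\<phi> x))" "continuous_on UNIV (\<lambda>x. \<beta>'' (\<phi> x))"
    using continuous_on_compose2[OF cb(2) C\<phi>(1)] continuous_on_compose2[OF cont C\<phi>(1)] by auto
  moreover have "continuous_on UNIV (\<lambda>x. blinfun_scaleR_left (D1 \<phi> x) o\<^sub>L D1 \<phi> x)"
    by (rule bounded_bilinear.continuous_on[OF bounded_bilinear_blinfun_compose
          bounded_linear.continuous_on[OF bounded_linear_blinfun_scaleR_left C\<phi>(2)] C\<phi>(2)])
  ultimately have "continuous_on UNIV ?A"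
    by (intro continuous_on_add continuous_on_scaleR contD2)
  moreover have "bounded (range (\<lambda>x. \<beta> (\<phi> x)))" by (rule bounded_continuous_comp[OF bnd(1) cb(1)])
  moreover obtain b1 b2 where b1: "\<And>x. \<bar>\<beta>' (\<phi> x)\<bar> \<le> b1" and b2: "\<And>x. \<bar>\<beta>'' (\<phi> x)\<bar> \<le> b2"
    using bounded_continuous_comp[OF bnd(1) cb(2)] bounded_continuous_comp[OF bnd(1) cont]
    unfolding bounded_iff by auto
  moreover obtain k1 k2 where k1: "\<And>x. norm (D1 \<phi> x) \<le> k1" and k2: "\<And>x. norm (D2 \<phi> x) \<le> k2"
    using bnd(2,3) unfolding bounded_iff by auto
  have b0: "0 \<le> b1" "0 \<le> b2" and k0: "0 \<le> k1"
    using order_trans[OF abs_ge_zero b1] order_trans[OF abs_ge_zero b2] order_trans[OF norm_ge_zero k1]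
    by auto
  have "norm (\<beta>' (\<phi> x) *\<^sub>R D1 \<phi> x) \<le> b1 * k1" for x
    using mult_mono[OF b1 k1] b0 by simp
  then have "bounded (range (\<lambda>x. \<beta>' (\<phi> x) *\<^sub>R D1 \<phi> x))" unfolding bounded_iff by blast
  moreover have "norm (?A x) \<le> b1 * k2 + b2 * (k1 * k1)" for x
  proof -
    have s: "norm (blinfun_scaleR_left (D1 \<phi> x)) \<le> norm (D1 \<phi> x)"
      by (rule norm_blinfun_bound) (simp_all add: mult.commute)
    have "norm (blinfun_scaleR_left (D1 \<phi> x) o\<^sub>L D1 \<phi> x) \<le> norm (blinfun_scaleR_left (D1 \<phi> x)) * norm (D1 \<phi> x)"
      by (rule norm_blinfun_compose)
    also have "\<dots> \<le> k1 * k1" by (intro mult_mono order_trans[OF s] k1 k0) auto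
    finally have "norm (\<beta>'' (\<phi> x) *\<^sub>R (blinfun_scaleR_left (D1 \<phi> x) o\<^sub>L D1 \<phi> x)) \<le> b2 * (k1 * k1)"
      using mult_mono[OF b2] b0 by simp
    moreover have "norm (\<beta>' (\<phi> x) *\<^sub>R D2 \<phi> x) \<le> b1 * k2" using mult_mono[OF b1 k2] b0 by simp
    ultimately show ?thesis by (intro norm_triangle_le) linarith
  qed
  then have "bounded (range ?A)" unfolding bounded_iff by blast
  moreover have "\<forall>x. (\<lambda>x. \<beta> (\<phi> x)) differentiable (at x)"
      "\<forall>x. (\<lambda>x. \<beta>' (\<phi> x) *\<^sub>R D1 \<phi> x) differentiable (at x)"
    using differentiableI[OF der1] differentiableI[OF der2] unfolding D1[abs_def] by auto
  ultimately show "(\<lambda>x. \<beta> (\<phi> x)) \<in> Cb2"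
    unfolding Cb2_def mem_Collect_eq D1[abs_def] D2[abs_def] by (intro conjI)
qed

section \<open>Summability of the eigenvalues\<close>

text \<open>
  The operator \<open>C\<close> is symmetric because it is diagonal in an orthonormal basis, so its absolute value
  \<open>A\<close> satisfies \<open>A\<^sup>2 b\<^sub>k = \<lambda>\<^sub>k\<^sup>2 b\<^sub>k\<close>. If \<open>\<lambda>\<^sub>k > 0\<close>, positivity of \<open>A\<close> excludes the
  eigenvalue \<open>-\<lambda>\<^sub>k\<close>. Hence \<open>A b\<^sub>k = \<lambda>\<^sub>k b\<^sub>k\<close> in all cases, and the trace of \<open>A\<close> is the sum of the \<open>\<lambda>\<^sub>k\<close>.
\<close>

lemma trace_class_eigenvalues_summable:
  fixes C :: "'h::{real_inner,complete_space} \<Rightarrow> 'h" and b :: "nat \<Rightarrow> 'h"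
  assumes tc: "trace_class C"
    and orth: "\<And>i j. b i \<bullet> b j = of_bool (i = j)" and total: "closure (span (range b)) = UNIV"
    and eig: "\<And>k. C (b k) = lam k *\<^sub>R b k" and lam: "\<And>k. 0 \<le> lam k"
  shows "summable lam"
proof -
  have C: "bounded_linear C" using tc unfolding trace_class_def by (rule conjunct1)
  obtain A where A: "bounded_linear A"
    and sa: "\<forall>x y. A x \<bullet> y = x \<bullet> A y" and pos: "\<forall>x. 0 \<le> A x \<bullet> x"
    and AC: "\<forall>x y. A x \<bullet> A y = C x \<bullet> C y"
    and tr: "\<forall>B. pairwise orthogonal B \<and> (\<forall>b\<in>B. norm b = 1) \<and> closure (span B) = UNIV
       \<longrightarrow> (\<lambda>b. A b \<bullet> b) summable_on B"
    using tc unfolding trace_class_def by (elim conjE exE)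
  interpret C: bounded_linear C by (rule C)
  interpret A: bounded_linear A by (rule A)
  have Csym: "b k \<bullet> C y = lam k * (b k \<bullet> y)" for k y
  proof -
    let ?S = "{y. b k \<bullet> C y = lam k * (b k \<bullet> y)}"
    have "subspace ?S"
      unfolding subspace_def by (auto simp: C.zero C.add C.scaleR inner_add_right algebra_simps)
    moreover have "range b \<subseteq> ?S" by (auto simp: eig orth)
    ultimately have "span (range b) \<subseteq> ?S" by (rule span_minimal[rotated])
    moreover have "closed ?S"
      by (intro closed_Collect_eq continuous_intros C.continuous_on)
    ultimately have "closure (span (range b)) \<subseteq> ?S" by (rule closure_minimal)
    then show ?thesis using total by blast
  qed
  have AA: "A (A (b k)) = (lam k)\<^sup>2 *\<^sub>R b k" for k
  proof -
    have "A (A (b k)) \<bullet> y = ((lam k)\<^sup>2 *\<^sub>R b k) \<bullet> y" for y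
      using sa[rule_format, of "A (b k)" y] AC[rule_format, of "b k" y] Csym[of k y]
      by (simp add: eig power2_eq_square)
    then show ?thesis by (metis vector_eq_rdot)
  qed
  have Ab: "A (b k) = lam k *\<^sub>R b k" for k
  proof (cases "lam k = 0")
    case True
    then show ?thesis using AC[rule_format, of "b k" "b k"] by (simp add: eig)
  next
    case False
    \<comment> \<open>From \<open>(A + \<lambda>\<^sub>k) (A - \<lambda>\<^sub>k) b\<^sub>k = 0\<close>, the vector \<open>u\<close> is an eigenvector for \<open>-\<lambda>\<^sub>k\<close> unless it vanishes.\<close>
    define u where "u = A (b k) - lam k *\<^sub>R b k"
    have "A u = - (lam k *\<^sub>R u)"
      unfolding u_def by (simp add: A.diff A.scaleR AA scaleR_diff_right power2_eq_square)
    then have "0 \<le> - (lam k * (u \<bullet> u))" using pos[rule_format, of u] by simp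
    then have "u \<bullet> u \<le> 0" using False lam[of k] by (simp add: mult_le_0_iff)
    then have "u = 0" by (metis inner_eq_zero_iff inner_ge_zero order_antisym)
    then show ?thesis unfolding u_def by simp
  qed
  have "inj b" by (rule injI) (metis orth of_bool_eq_1_iff)
  have "pairwise orthogonal (range b)"
    unfolding pairwise_def orthogonal_def by (auto simp: orth)
  moreover have "\<forall>v\<in>range b. norm v = 1" using orth by (auto simp: norm_eq_sqrt_inner)
  ultimately have "(\<lambda>v. A v \<bullet> v) summable_on range b" using tr total by blast
  then have "lam summable_on UNIV"
    using \<open>inj b\<close> by (simp add: summable_on_reindex o_def Ab orth)
  then show ?thesis by (simp add: summable_on_UNIV_nonneg_real_iff lam)
qed

section \<open>Convex functionals and infinitesimally excessive measures\<close>

text \<open>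
  The carre du champ of the diffusion operator: twice the defect in its chain rule for \<open>\<beta>(s) = s\<^sup>2/2\<close>.
\<close>

definition squared_gradient ::
  "(nat \<Rightarrow> real) \<Rightarrow> (nat \<Rightarrow> 'h) \<Rightarrow> ('h::real_normed_vector \<Rightarrow> real) \<Rightarrow> 'h \<Rightarrow> real" where
  "squared_gradient lam b \<phi> x = (\<Sum>k. lam k * (D1 \<phi> x (b k))\<^sup>2)"

lemma squared_gradient_bounds:
  assumes lam: "summable lam" "\<And>k. 0 \<le> lam k" and b: "\<And>k. norm (b k) = 1"
  shows "summable (\<lambda>k. lam k * (D1 \<phi> x (b k))\<^sup>2)"
    and "0 \<le> squared_gradient lam b \<phi> x"
    and "squared_gradient lam b \<phi> x \<le> suminf lam * (norm (D1 \<phi> x))\<^sup>2"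
proof -
  have le: "lam k * (D1 \<phi> x (b k))\<^sup>2 \<le> lam k * (norm (D1 \<phi> x))\<^sup>2" for k
  proof (rule mult_left_mono[OF _ lam(2)])
    show "(D1 \<phi> x (b k))\<^sup>2 \<le> (norm (D1 \<phi> x))\<^sup>2"
      using power_mono[of "\<bar>D1 \<phi> x (b k)\<bar>" "norm (D1 \<phi> x)" 2] norm_blinfun[of "D1 \<phi> x" "b k"] b by simp
  qed
  have sum: "summable (\<lambda>k. lam k * (norm (D1 \<phi> x))\<^sup>2)" by (rule summable_mult2[OF lam(1)])
  show 1: "summable (\<lambda>k. lam k * (D1 \<phi> x (b k))\<^sup>2)"
    by (rule summable_comparison_test'[OF sum, of 0]) (use le lam(2) in simp)
  show "0 \<le> squared_gradient lam b \<phi> x"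
    unfolding squared_gradient_def by (rule suminf_nonneg[OF 1]) (use lam(2) in simp)
  show "squared_gradient lam b \<phi> x \<le> suminf lam * (norm (D1 \<phi> x))\<^sup>2"
    unfolding squared_gradient_def suminf_mult2[OF lam(1)] by (rule suminf_le[OF le 1 sum])
qed

text \<open>
  The drift of \<open>N\<^sub>0\<close> is a derivation; the second order part produces the extra term because
  \<open>D\<^sup>2(\<beta> \<circ> \<phi>)(b, b) = \<beta>'(\<phi>) D\<^sup>2\<phi>(b, b) + \<beta>''(\<phi>) (D\<phi>(b))\<^sup>2\<close>. Summability of \<open>lam\<close> allows the series to be
  split.
\<close>

lemma N0_comp:
  fixes J :: "'h::{real_inner,complete_space} \<Rightarrow> ('a::euclidean_space \<Rightarrow> real) \<Rightarrow> real"
  assumes \<phi>: "\<phi> \<in> Cb2"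
    and d1: "\<And>s. (\<beta> has_real_derivative \<beta>' s) (at s)"
    and d2: "\<And>s. (\<beta>' has_real_derivative \<beta>'' s) (at s)"
    and cont: "continuous_on UNIV \<beta>''"
    and lam: "summable lam" "\<And>k. 0 \<le> lam k" and b: "\<And>k. norm (of_L2 D J (e k)) = 1"
  shows "N0 D J e lam \<Psi> (\<lambda>x. \<beta> (\<phi> x)) x = \<beta>' (\<phi> x) * N0 D J e lam \<Psi> \<phi> x
      + 1/2 * \<beta>'' (\<phi> x) * squared_gradient lam (\<lambda>k. of_L2 D J (e k)) \<phi> x"
proof -
  define b' where "b' k = of_L2 D J (e k)" for k
  have b': "norm (b' k) = 1" for k using b by (simp add: b'_def)
  define u where "u k = lam k * D2 \<phi> x (b' k) (b' k)" for k
  define w where "w k = lam k * (D1 \<phi> x (b' k))\<^sup>2" for k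
  have u: "summable u"
  proof (rule summable_comparison_test'[OF summable_mult2[OF lam(1), of "norm (D2 \<phi> x)"], of 0])
    fix k :: nat
    have "\<bar>D2 \<phi> x (b' k) (b' k)\<bar> \<le> norm (D2 \<phi> x (b' k))"
      using norm_blinfun[of "D2 \<phi> x (b' k)" "b' k"] b' by simp
    also have "\<dots> \<le> norm (D2 \<phi> x)" using norm_blinfun[of "D2 \<phi> x" "b' k"] b' by simp
    finally show "norm (u k) \<le> lam k * norm (D2 \<phi> x)"
      unfolding u_def using lam(2)[of k] by (simp add: abs_mult mult_left_mono)
  qed
  have w: "summable w" unfolding w_def by (rule squared_gradient_bounds(1)[OF lam b'])
  have "lam k * D2 (\<lambda>x. \<beta> (\<phi> x)) x (b' k) (b' k) = \<beta>' (\<phi> x) * u k + \<beta>'' (\<phi> x) * w k" for k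
    unfolding D2_comp[OF \<phi> d1 d2 cont] u_def w_def
    by (simp add: plus_blinfun.rep_eq scaleR_blinfun.rep_eq power2_eq_square algebra_simps)
  then have "(\<Sum>k. lam k * D2 (\<lambda>x. \<beta> (\<phi> x)) x (b' k) (b' k)) = \<beta>' (\<phi> x) * suminf u + \<beta>'' (\<phi> x) * suminf w"
    by (simp add: suminf_add[symmetric] summable_mult u w suminf_mult)
  moreover have "D1 (\<lambda>x. \<beta> (\<phi> x)) x v = \<beta>' (\<phi> x) * D1 \<phi> x v" for v
    unfolding D1_comp[OF \<phi> d1 d2 cont] by (simp add: scaleR_blinfun.rep_eq)
  ultimately show ?thesis
    unfolding N0_def b'_def[symmetric] squared_gradient_def
    by (simp add: u_def[symmetric] w_def[symmetric] algebra_simps)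
qed

lemma Cb2_bounded_comp_Lsq:
  fixes f :: "real \<Rightarrow> real" and M :: "'h::real_normed_vector measure"
  assumes M: "finite_measure M" "sets M = sets borel" and \<phi>: "\<phi> \<in> Cb2" and f: "continuous_on UNIV f"
  shows "(\<lambda>x. f (\<phi> x)) \<in> Lsq M"
proof -
  interpret finite_measure M by (rule M)
  have "bounded (range \<phi>)" using \<phi> unfolding Cb2_def by blast
  from bounded_continuous_comp[OF this f] obtain B where B: "\<And>x. \<bar>f (\<phi> x)\<bar> \<le> B"
    unfolding bounded_iff by auto
  have "(\<lambda>x. f (\<phi> x)) \<in> borel_measurable borel"
    by (rule borel_measurable_continuous_onI[OF continuous_on_compose2[OF f Cb2_continuous(1)[OF \<phi>]]]) simp
  then have "(\<lambda>x. f (\<phi> x)) \<in> borel_measurable M"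
    using measurable_cong_sets[OF M(2) refl] by blast
  then show ?thesis using B by (rule Lsq_bounded)
qed

text \<open>
  The test function is \<open>\<beta> \<circ> \<phi>\<close>. By the chain rule \<open>N\<^sub>0(\<beta> \<circ> \<phi>)\<close> is integrable as soon as \<open>N\<^sub>0\<phi>\<close> is square
  integrable, because the remaining part is a bounded function, measurable as a series of continuous ones.
\<close>

lemma N0_convex_integral_le:
  fixes J :: "'h::{real_inner,complete_space} \<Rightarrow> ('a::euclidean_space \<Rightarrow> real) \<Rightarrow> real"
  assumes exc: "inf_excessive D J e lam \<Psi> \<nu> c" and \<beta>: "smooth_convex \<beta> \<beta>' \<beta>'' L K"
    and lam: "summable lam" "\<And>k. 0 \<le> lam k" and b: "\<And>k. norm (of_L2 D J (e k)) = 1"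
    and \<phi>: "\<phi> \<in> Cb2" and N\<phi>: "N0 D J e lam \<Psi> \<phi> \<in> Lsq \<nu>"
  shows "(\<integral>x. \<beta>' (\<phi> x) * N0 D J e lam \<Psi> \<phi> x \<partial>\<nu>) \<le> c * (\<integral>x. \<beta> (\<phi> x) \<partial>\<nu>)"
proof -
  interpret prob_space \<nu> using exc unfolding inf_excessive_def by blast
  interpret \<beta>: smooth_convex \<beta> \<beta>' \<beta>'' L K by (rule \<beta>)
  have sets: "sets \<nu> = sets borel" using exc unfolding inf_excessive_def by blast
  let ?N = "N0 D J e lam \<Psi>" and ?G = "squared_gradient lam (\<lambda>k. of_L2 D J (e k)) \<phi>"
  note G = squared_gradient_bounds[of lam "\<lambda>k. of_L2 D J (e k)" \<phi>, OF lam b]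
  have comp: "?N (\<lambda>x. \<beta> (\<phi> x)) x = \<beta>' (\<phi> x) * ?N \<phi> x + 1/2 * \<beta>'' (\<phi> x) * ?G x" for x
    by (rule N0_comp[OF \<phi> \<beta>.deriv \<beta>.deriv2 \<beta>.continuous2 lam b])
  obtain B where B: "\<And>x. norm (D1 \<phi> x) \<le> B"
    using \<phi> unfolding Cb2_def bounded_iff by auto
  have GL: "?G \<in> Lsq \<nu>"
  proof (rule Lsq_bounded)
    have "?G \<in> borel_measurable borel"
      unfolding squared_gradient_def
    proof (rule borel_measurable_suminf)
      fix k
      have "continuous_on UNIV (\<lambda>x. lam k * (D1 \<phi> x (of_L2 D J (e k)))\<^sup>2)"
        by (intro continuous_intros Cb2_continuous[OF \<phi>])
      then show "(\<lambda>x. lam k * (D1 \<phi> x (of_L2 D J (e k)))\<^sup>2) \<in> borel_measurable borel"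
        by (rule borel_measurable_continuous_onI)
    qed
    then show "?G \<in> borel_measurable \<nu>" using measurable_cong_sets[OF sets refl] by blast
    have sl: "0 \<le> suminf lam" using suminf_nonneg[OF lam] .
    show "\<bar>?G x\<bar> \<le> suminf lam * B\<^sup>2" for x
      using G(2,3)[of x] mult_left_mono[OF power_mono[OF B norm_ge_zero, of x 2] sl] by linarith
  qed
  have c1: "continuous_on UNIV \<beta>'" by (rule lipschitz_on_continuous_on[OF \<beta>.deriv_lipschitz])
  have i1: "integrable \<nu> (\<lambda>x. \<beta>' (\<phi> x) * ?N \<phi> x)"
    by (rule Lsq_mult_integrable[OF Cb2_bounded_comp_Lsq[OF finite_measure_axioms sets \<phi> c1] N\<phi>])
  have i2: "integrable \<nu> (\<lambda>x. \<beta>'' (\<phi> x) * ?G x)"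
    by (rule Lsq_mult_integrable[OF Cb2_bounded_comp_Lsq[OF finite_measure_axioms sets \<phi> \<beta>.continuous2] GL])
  have "(\<integral>x. \<beta>' (\<phi> x) * ?N \<phi> x \<partial>\<nu>) \<le> (\<integral>x. ?N (\<lambda>x. \<beta> (\<phi> x)) x \<partial>\<nu>)"
  proof (rule integral_mono[OF i1])
    have "integrable \<nu> (\<lambda>x. \<beta>' (\<phi> x) * ?N \<phi> x + 1/2 * (\<beta>'' (\<phi> x) * ?G x))"
      by (intro Bochner_Integration.integrable_add i1 integrable_mult_right i2)
    then show "integrable \<nu> (\<lambda>x. ?N (\<lambda>x. \<beta> (\<phi> x)) x)" unfolding comp by (simp add: mult.assoc)
    show "\<beta>' (\<phi> x) * ?N \<phi> x \<le> ?N (\<lambda>x. \<beta> (\<phi> x)) x" for x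
      unfolding comp using \<beta>.convex[of "\<phi> x"] G(2)[of x] by simp
  qed
  also have "\<dots> \<le> c * (\<integral>x. \<beta> (\<phi> x) \<partial>\<nu>)"
  proof -
    have "\<forall>\<psi>\<in>Cb2. (AE x in \<nu>. 0 \<le> \<psi> x) \<longrightarrow> (\<integral>x. ?N \<psi> x \<partial>\<nu>) \<le> c * (\<integral>x. \<psi> x \<partial>\<nu>)"
      using exc unfolding inf_excessive_def by (elim conjE)
    from bspec[OF this Cb2_comp[OF \<phi> \<beta>.deriv \<beta>.deriv2 \<beta>.continuous2]]
    show ?thesis by (simp add: \<beta>.nonneg)
  qed
  finally show ?thesis .
qed

text \<open>
  An approximating sequence in the graph of \<open>N\<^sub>0\<close> eventually has both components in \<open>L\<^sup>2(\<nu>)\<close>, so the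
  previous inequality applies to its members and passes to the limit.
\<close>

lemma N2_convex_integral_le:
  fixes J :: "'h::{real_inner,complete_space} \<Rightarrow> ('a::euclidean_space \<Rightarrow> real) \<Rightarrow> real"
  assumes exc: "inf_excessive D J e lam \<Psi> \<nu> c" and \<beta>: "smooth_convex \<beta> \<beta>' \<beta>'' L K"
    and lam: "summable lam" "\<And>k. 0 \<le> lam k" and b: "\<And>k. norm (of_L2 D J (e k)) = 1"
    and fg: "(f, g) \<in> N2 D J e lam \<Psi> \<nu>"
  shows "(\<integral>x. \<beta>' (f x) * g x \<partial>\<nu>) \<le> c * (\<integral>x. \<beta> (f x) \<partial>\<nu>)"
proof -
  interpret prob_space \<nu> using exc unfolding inf_excessive_def by blast
  interpret \<beta>: smooth_convex \<beta> \<beta>' \<beta>'' L K by (rule \<beta>)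
  obtain s where s: "\<forall>n. s n \<in> {(\<phi>, N0 D J e lam \<Psi> \<phi>) | \<phi>. \<phi> \<in> Cb2}"
    and f: "Lsq_tendsto \<nu> (\<lambda>n. fst (s n)) f sequentially"
    and g: "Lsq_tendsto \<nu> (\<lambda>n. snd (s n)) g sequentially"
    using fg unfolding N2_def Lsq_closure_def mem_Collect_eq case_prod_conv by (elim exE conjE)
  have l1: "(\<lambda>n. \<integral>x. \<beta>' (fst (s n) x) * snd (s n) x \<partial>\<nu>) \<longlonglongrightarrow> (\<integral>x. \<beta>' (f x) * g x \<partial>\<nu>)"
    by (rule Lsq_tendsto_integral_mult[OF Lsq_tendsto_lipschitz_comp[OF \<beta>.deriv_lipschitz f] g])
  have l2: "(\<lambda>n. c * (\<integral>x. \<beta> (fst (s n) x) \<partial>\<nu>)) \<longlonglongrightarrow> c * (\<integral>x. \<beta> (f x) \<partial>\<nu>)"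
    by (intro tendsto_mult_left Lsq_tendsto_integral[OF Lsq_tendsto_lipschitz_comp[OF \<beta>.lipschitz f]])
  have "\<forall>\<^sub>F n in sequentially. snd (s n) \<in> Lsq \<nu>" using g unfolding Lsq_tendsto_def by blast
  then have "\<forall>\<^sub>F n in sequentially.
      (\<integral>x. \<beta>' (fst (s n) x) * snd (s n) x \<partial>\<nu>) \<le> c * (\<integral>x. \<beta> (fst (s n) x) \<partial>\<nu>)"
  proof eventually_elim
    case (elim n)
    obtain \<phi> where \<phi>: "\<phi> \<in> Cb2" "s n = (\<phi>, N0 D J e lam \<Psi> \<phi>)" using s by blast
    show ?case
      using N0_convex_integral_le[OF exc \<beta> lam b \<phi>(1)] elim unfolding \<phi>(2) by simp
  qed
  then show ?thesis by (rule tendsto_le[OF trivial_limit_sequentially l2 l1])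
qed

lemma const_in_N2_kernel:
  assumes "prob_space \<nu>"
  shows "(\<lambda>x. c, \<lambda>x. 0) \<in> N2 D J e lam \<Psi> \<nu>"
proof -
  interpret prob_space \<nu> by (rule assms)
  have "N0 D J e lam \<Psi> (\<lambda>x. c) = (\<lambda>x. 0)"
    unfolding N0_def D1_const D2_const by simp
  then have graph: "(\<lambda>x. c, \<lambda>x. 0) \<in> {(\<phi>, N0 D J e lam \<Psi> \<phi>) | \<phi>. \<phi> \<in> Cb2}"
    using Cb2_const[of c] by (intro CollectI exI[of _ "\<lambda>x. c"]) simp
  show ?thesis
    unfolding N2_def Lsq_closure_def mem_Collect_eq[of "(\<lambda>x. c, \<lambda>x. 0)"] case_prod_conv
  proof (intro exI[of _ "\<lambda>n. (\<lambda>x. c, \<lambda>x. 0)"] conjI allI)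
    show "(\<lambda>x. c, \<lambda>x. 0) \<in> {(\<phi>, N0 D J e lam \<Psi> \<phi>) | \<phi>. \<phi> \<in> Cb2}" by (rule graph)
  qed (simp_all only: fst_conv snd_conv Lsq_tendsto_const[OF Lsq_const])
qed

section \<open>Markov property and growth bound\<close>

theorem corollary4p2:
  fixes D :: "(real ^ 'd) set"
    and J :: "'h::{real_inner,complete_space} \<Rightarrow> (real ^ 'd \<Rightarrow> real) \<Rightarrow> real"
    and e :: "nat \<Rightarrow> real ^ 'd \<Rightarrow> real"
    and C :: "'h \<Rightarrow> 'h"
    and lam :: "nat \<Rightarrow> real"
    and \<Psi> :: "real \<Rightarrow> real"
    and r \<kappa>\<^sub>0 \<kappa>\<^sub>1 C\<^sub>1 :: real
    and \<nu> :: "'h measure"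
    and lam\<^sub>\<nu> :: real
    and P :: "real \<Rightarrow> ('h \<Rightarrow> real) \<Rightarrow> 'h \<Rightarrow> real"
  assumes "open D" and "bounded D"
    and "is_Hm1 D J" and "is_eigenbasis D J e"
    and "trace_class C"
    and "\<And>k. C (of_L2 D J (e k)) = lam k *\<^sub>R of_L2 D J (e k)"
    and "\<And>k. 0 \<le> lam k"
    and "(\<Sum>k. (SUP \<xi>\<in>D. ennreal ((e k \<xi>)\<^sup>2)) * ennreal (lam k)) < \<infinity>"
    and "\<Psi> C1_differentiable_on UNIV"
    and "1 < r" and "0 < \<kappa>\<^sub>0" and "0 < \<kappa>\<^sub>1" and "0 < C\<^sub>1"
    and "\<And>s. \<kappa>\<^sub>0 * \<bar>s\<bar> powr (r - 1) \<le> deriv \<Psi> s"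
    and "\<And>s. deriv \<Psi> s \<le> \<kappa>\<^sub>1 * \<bar>s\<bar> powr (r - 1) + C\<^sub>1"
    and "inf_excessive D J e lam \<Psi> \<nu> lam\<^sub>\<nu>"
    and "C0_semigroup \<nu> P" and "generator \<nu> P = N2 D J e lam \<Psi> \<nu>"
  shows "(\<forall>f \<in> Domain (N2 D J e lam \<Psi> \<nu>).
            solves_Cauchy \<nu> (N2 D J e lam \<Psi> \<nu>) f (\<lambda>t. P t f))
       \<and> (\<forall>t\<ge>0. (AE x in \<nu>. P t (\<lambda>_. 1) x = 1) \<and>
            (\<forall>f \<in> Lsq \<nu>. (AE x in \<nu>. 0 \<le> f x) \<longrightarrow> (AE x in \<nu>. 0 \<le> P t f x)))
       \<and> (\<forall>f \<in> Lsq \<nu>. (AE x in \<nu>. 0 \<le> f x) \<longrightarrow>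
            (\<forall>t>0. (\<integral>x. P t f x \<partial>\<nu>) \<le> exp (lam\<^sub>\<nu> * t) * (\<integral>x. f x \<partial>\<nu>)))"
proof -
  note exc = \<open>inf_excessive D J e lam \<Psi> \<nu> lam\<^sub>\<nu>\<close> and sg = \<open>C0_semigroup \<nu> P\<close>
    and gen = \<open>generator \<nu> P = N2 D J e lam \<Psi> \<nu>\<close> and lam = \<open>\<And>k. 0 \<le> lam k\<close>
  have prob: "prob_space \<nu>" using exc unfolding inf_excessive_def by blast
  interpret prob_space \<nu> by (rule prob)
  have orth: "of_L2 D J (e i) \<bullet> of_L2 D J (e j) = of_bool (i = j)" for i j
    using \<open>is_eigenbasis D J e\<close> unfolding is_eigenbasis_def by blast
  have total: "closure (span (range (\<lambda>k. of_L2 D J (e k)))) = UNIV"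
    using \<open>is_eigenbasis D J e\<close> unfolding is_eigenbasis_def by blast
  have summable: "summable lam"
    by (rule trace_class_eigenvalues_summable[OF \<open>trace_class C\<close> orth total assms(6) lam])
  have unit: "norm (of_L2 D J (e k)) = 1" for k
    using orth[of k k] by (simp add: norm_eq_sqrt_inner)
  have growth: "(\<integral>x. \<bar>P t f x\<bar> + a * P t f x \<partial>\<nu>) \<le> exp (lam\<^sub>\<nu> * t) * (\<integral>x. \<bar>f x\<bar> + a * f x \<partial>\<nu>)"
    if "f \<in> Lsq \<nu>" "t \<ge> 0" "\<bar>a\<bar> \<le> 1" for f t a
    by (rule semigroup_abs_integral_growth[OF sg N2_convex_integral_le[OF exc _ summable lam unit, folded gen] that])
  have cauchy: "solves_Cauchy \<nu> (N2 D J e lam \<Psi> \<nu>) f (\<lambda>t. P t f)"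
    if "f \<in> Domain (N2 D J e lam \<Psi> \<nu>)" for f
  proof -
    obtain g where fg: "(f, g) \<in> generator \<nu> P" using \<open>f \<in> Domain _\<close> gen by blast
    then have f: "f \<in> Lsq \<nu>" unfolding generator_def by blast
    show ?thesis
      unfolding solves_Cauchy_def gen[symmetric]
    proof (intro conjI allI impI)
      show "AE x in \<nu>. P 0 f x = f x" "Lsq_tendsto \<nu> (\<lambda>t. P t f) f (at_right 0)"
        using sg f unfolding C0_semigroup_def by blast+
      show "\<exists>g. (P t f, g) \<in> generator \<nu> P \<and> Lsq_tendsto \<nu> (\<lambda>s x. (P s f x - P t f x) / (s - t)) g (at t)"
        if "t > 0" for t
        using generator_orbit[OF sg fg, of t] semigroup_Lsq_derivative[OF sg fg that] that by auto
    qed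
  qed
  have one: "AE x in \<nu>. P t (\<lambda>_. 1) x = 1" if "t \<ge> 0" for t
    using semigroup_fixes_kernel[OF sg _ that] const_in_N2_kernel[OF prob] gen by blast
  have pos: "AE x in \<nu>. 0 \<le> P t f x" if f: "f \<in> Lsq \<nu>" and f0: "AE x in \<nu>. 0 \<le> f x" and t: "t \<ge> 0" for f t
  proof -
    have Pf: "P t f \<in> Lsq \<nu>" by (rule C0_semigroup_Lsq[OF sg t f])
    have "(\<integral>x. \<bar>f x\<bar> + (-1) * f x \<partial>\<nu>) = 0"
      by (rule integral_eq_zero_AE) (use f0 in \<open>eventually_elim, simp\<close>)
    then have "(\<integral>x. \<bar>P t f x\<bar> + (-1) * P t f x \<partial>\<nu>) \<le> 0" using growth[OF f t, of "-1"] by simp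
    moreover have "0 \<le> (\<integral>x. \<bar>P t f x\<bar> + (-1) * P t f x \<partial>\<nu>)"
      by (rule Bochner_Integration.integral_nonneg) simp
    ultimately have "(\<integral>x. \<bar>P t f x\<bar> + (-1) * P t f x \<partial>\<nu>) = 0" by linarith
    moreover have "integrable \<nu> (\<lambda>x. \<bar>P t f x\<bar> + (-1) * P t f x)" using Lsq_integrable[OF Pf] by auto
    ultimately have "AE x in \<nu>. \<bar>P t f x\<bar> + (-1) * P t f x = 0"
      by (subst (asm) integral_nonneg_eq_0_iff_AE) auto
    then show ?thesis by eventually_elim linarith
  qed
  have excess: "(\<integral>x. P t f x \<partial>\<nu>) \<le> exp (lam\<^sub>\<nu> * t) * (\<integral>x. f x \<partial>\<nu>)"
    if f: "f \<in> Lsq \<nu>" and f0: "AE x in \<nu>. 0 \<le> f x" and t: "t \<ge> 0" for f t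
  proof -
    have Pf: "P t f \<in> Lsq \<nu>" by (rule C0_semigroup_Lsq[OF sg t f])
    have "(\<integral>x. P t f x \<partial>\<nu>) \<le> (\<integral>x. \<bar>P t f x\<bar> \<partial>\<nu>)"
      by (intro integral_mono integrable_abs Lsq_integrable[OF Pf]) simp
    also have "\<dots> \<le> exp (lam\<^sub>\<nu> * t) * (\<integral>x. \<bar>f x\<bar> \<partial>\<nu>)" using growth[OF f t, of 0] by simp
    also have "(\<integral>x. \<bar>f x\<bar> \<partial>\<nu>) = (\<integral>x. f x \<partial>\<nu>)"
      by (rule integral_cong_AE) (use f f0 in \<open>auto simp: Lsq_def\<close>)
    finally show ?thesis .
  qed
  show ?thesis using cauchy one pos excess by (simp add: less_imp_le)
qed

end
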